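(* Let $G$ be a finite simple undirected graph, let $K$ be a field, and let $I_G$ be the toric ideal of $G$ over $K$. Let $n$ be a real number such that every circuit in $I_G$ has degree at most $n$. Then every primitive element (i.e. every element of the Graver basis) of $I_G$ has degree at most $n^2 e^{\frac{2n}{e}}$, where $e$ in this bound denotes the base of the natural logarithm.
   Context: Let $G=(V,E)$ be a finite simple undirected graph with $E=\{e_1,\dots,e_m\}$. Let $A$ be its vertex-edge incidence matrix: rows are indexed by the vertices, columns by the edges, and the column $a_j\in\mathbb{Z}^{V}$ of the edge $e_j$ is the $0$-$1$ vector with exactly two ones, at the two endpoints of $e_j$. The toric ideal $I_G\subset K[e_1,\dots,e_m]$ (the edges are used as polynomial variables) is the kernel of the $K$-algebra homomorphism $\phi:K[e_1,\dots,e_m]\to K[y_v^{\pm 1}: v\in V]$ given by $\phi(e_j)=y^{a_j}$, i.e. $\phi(e_j)=y_v y_w$ if $e_j=\{v,w\}$. For $u\in\mathbb{N}^m$ write $x^u=e_1^{u_1}\cdots e_m^{u_m}$. For $u\in\mathbb{Z}^m$ let $u^+,u^-\in\mathbb{N}^m$ be the unique vectors with disjoint supports and $u=u^+-u^-$. A binomial means a (nonzero) difference of two monomials $x^u-x^v$ with $u\ne v$. Every irreducible binomial in $I_G$ has the form $x^{u^+}-x^{u^-}$ for some nonzero $u\in\ker A\cap \mathbb{Z}^m$. An irreducible binomial $x^{u^+}-x^{u^-}\in I_G$ is called primitive if there is no other binomial $x^{v^+}-x^{v^-}\in I_G$ (with $v\neq 0$, $v\neq u$) such that $x^{v^+}$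 divides $x^{u^+}$ and $x^{v^-}$ divides $x^{u^-}$. The set of primitive binomials is the Graver basis of $I_G$. An irreducible binomial $x^u-x^v\in I_G$ is called a circuit if its support $\{i: e_i \text{ divides } x^{u+v}\}$ is minimal with respect to inclusion among the supports of binomials in $I_G$. The degree of a binomial is its usual total degree as a polynomial, each variable $e_j$ having degree $1$ (both monomials of a binomial in $I_G$ have the same total degree). *)

theory Defs
  imports Complex_Main "HOL-Library.Poly_Mapping"
    "HOL-Computational_Algebra.Factorial_Ring"
begin

definition simple_graph :: "'v set \<Rightarrow> 'v set set \<Rightarrow> bool" where
  "simple_graph V E \<longleftrightarrow> finite V \<and> (\<forall>e\<in>E. e \<subseteq> V \<and> card e = 2)"

(* The type "('x, 'k) mpoly" is the polynomial ring over 'k in the variables 'x: a polynomial maps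
   exponent vectors (finitely supported functions 'x \<Rightarrow> nat) to coefficients, and multiplication is
   the convolution product of HOL-Library.Poly_Mapping.  Laurent polynomials allow integer
   exponents. *)
type_synonym ('x, 'k) mpoly = "('x \<Rightarrow>\<^sub>0 nat) \<Rightarrow>\<^sub>0 'k"
type_synonym ('x, 'k) laurent = "('x \<Rightarrow>\<^sub>0 int) \<Rightarrow>\<^sub>0 'k"

definition var :: "'x \<Rightarrow> ('x, 'k::field) mpoly" where
  "var x = Poly_Mapping.single (Poly_Mapping.single x 1) 1"

definition mon :: "('x \<Rightarrow>\<^sub>0 nat) \<Rightarrow> ('x, 'k::field) mpoly" where
  "mon u = Poly_Mapping.single u 1"

definition mon_degree :: "('x \<Rightarrow>\<^sub>0 nat) \<Rightarrow> nat" where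
  "mon_degree m = (\<Sum>x\<in>Poly_Mapping.keys m. Poly_Mapping.lookup m x)"

definition total_degree :: "('x, 'k::field) mpoly \<Rightarrow> nat" where
  "total_degree p = Max (insert 0 (mon_degree ` Poly_Mapping.keys p))"

(* K[E] inside the ring in all variables.  This subring is closed under taking factors of its nonzero
   elements and has the same units (the nonzero constants), so "dvd" and "irreducible" mean the same
   for its elements in either ring. *)
definition polys_in :: "'x set \<Rightarrow> ('x, 'k::field) mpoly set" where
  "polys_in E = {p. \<forall>m\<in>Poly_Mapping.keys p. Poly_Mapping.keys m \<subseteq> E}"

definition incidence_column :: "'v set \<Rightarrow> ('v \<Rightarrow>\<^sub>0 int)" where
  "incidence_column e = (\<Sum>v\<in>e. Poly_Mapping.single v 1)"

(* The K-algebra homomorphism with e \<mapsto> y^(a_e), where a_e is the incidence column of e. *)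
definition toric_hom :: "('v set, 'k::field) mpoly \<Rightarrow> ('v, 'k) laurent" where
  "toric_hom p =
     (\<Sum>m\<in>Poly_Mapping.keys p. 
        Poly_Mapping.single 0 (Poly_Mapping.lookup p m) *
        (\<Prod>e\<in>Poly_Mapping.keys m. Poly_Mapping.single (incidence_column e) 1 ^ Poly_Mapping.lookup m e))"

definition toric_ideal :: "'v set set \<Rightarrow> ('v set, 'k::field) mpoly set" where
  "toric_ideal E = {p \<in> polys_in E. toric_hom p = 0}"

definition pos_part :: "('x \<Rightarrow>\<^sub>0 int) \<Rightarrow> ('x \<Rightarrow>\<^sub>0 nat)" where
  "pos_part u = Poly_Mapping.map nat u"

definition neg_part :: "('x \<Rightarrow>\<^sub>0 int) \<Rightarrow> ('x \<Rightarrow>\<^sub>0 nat)" where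
  "neg_part u = Poly_Mapping.map nat (- u)"

definition graver_basis :: "'v set set \<Rightarrow> ('v set, 'k::field) mpoly set" where
  "graver_basis E =
     {p \<in> toric_ideal E. irreducible p \<and>
        (\<exists>u. p = mon (pos_part u) - mon (neg_part u) \<and>
           \<not> (\<exists>v. v \<noteq> 0 \<and> v \<noteq> u \<and>
                 mon (pos_part v) - mon (neg_part v) \<in> (toric_ideal E :: ('v set, 'k) mpoly set) \<and>
                 (mon (pos_part v) :: ('v set, 'k) mpoly) dvd mon (pos_part u) \<and>
                 (mon (neg_part v) :: ('v set, 'k) mpoly) dvd mon (neg_part u)))}"

definition binomials :: "'v set set \<Rightarrow> ('v set, 'k::field) mpoly itself \<Rightarrow>
    (('v set \<Rightarrow>\<^sub>0 nat) \<times> ('v set \<Rightarrow>\<^sub>0 nat)) set" where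
  "binomials E T =
     {(u, v). u \<noteq> v \<and> mon u - mon v \<in> (toric_ideal E :: ('v set, 'k) mpoly set)}"

definition binomial_support :: "'v set set \<Rightarrow> ('v set, 'k::field) mpoly itself \<Rightarrow>
    ('v set \<Rightarrow>\<^sub>0 nat) \<Rightarrow> ('v set \<Rightarrow>\<^sub>0 nat) \<Rightarrow> 'v set set" where
  "binomial_support E T u v = {e \<in> E. (var e :: ('v set, 'k) mpoly) dvd mon (u + v)}"

definition circuits :: "'v set set \<Rightarrow> ('v set, 'k::field) mpoly set" where
  "circuits E =
     {p. irreducible p \<and>
        (\<exists>u v. p = mon u - mon v \<and>
           (u, v) \<in> binomials E TYPE(('v set, 'k) mpoly) \<and>
           \<not> (\<exists>(u', v') \<in> binomials E TYPE(('v set, 'k) mpoly).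
                 binomial_support E TYPE(('v set, 'k) mpoly) u' v'
                   \<subset> binomial_support E TYPE(('v set, 'k) mpoly) u v))}"

end

theory Submission
  imports Defs "HOL-Library.Multiset"
begin

text \<open>
Let \<open>x^P - x^N\<close> be a primitive binomial, with \<open>P\<close> and \<open>N\<close> read as multisets of edges. Membership in the
toric ideal says that every vertex meets \<open>P\<close> and \<open>N\<close> equally often, and primitivity says that no
proper nonempty pair of submultisets has this property. A longest trail that uses edges of \<open>P\<close> and of
\<open>N\<close> in turn cannot stop before it closes up, so \<open>P + N\<close> is the edge multiset of one alternating
closed walk (\<open>primitive_pair_closed_walk\<close>).

An even closed piece of this walk would again be balanced. Hence two visits to a vertex lie an odd
number of steps apart, and two repeated vertices \<open>y\<close>, \<open>z\<close> cannot interleave as \<open>y z y z\<close>, because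
then the two pieces from \<open>y\<close> to \<open>z\<close> would together be balanced (\<open>primitive_walk_repeat\<close>,
\<open>primitive_walk_no_crossing\<close>). So the repetitions are nested like parentheses, and the walk is a
tree of cycles glued at vertices, a cactus, in which a bridge that is crossed twice counts as a cycle of
length two (\<open>noncrossing_odd_forest\<close>).

If no vertex is repeated, the walk is an even cycle, which is itself a circuit. Otherwise cut it at a
repeated vertex \<open>x\<close> into two odd closed walks. In each of them descend from \<open>x\<close> through the tree of
cycles to a leaf, which is an odd cycle, always taking the longer way round every cycle that is passed.
This yields a path from \<open>x\<close> with an odd cycle at its end. Let \<open>H\<close> be the length of the cycle plus
twice that of the path; then \<open>H\<close> is at least the sum of the lengths of the cycles on the way. A
cycle of length \<open>k\<close> has fewer than \<open>k\<close> children, and \<open>k \<le> exp (k / e)\<close>, so choosing the child with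
the largest value at every step gives the bound \<open>H * exp (H / e)\<close> for the length of the whole odd
closed walk (\<open>cactus_lollipop\<close>).

The two paths with their odd cycles, joined at \<open>x\<close>, form a dumbbell. Its alternating closed walk is a
circuit of degree \<open>(H1 + H2) / 2\<close> (\<open>large_circuit\<close>), so \<open>H1 + H2 \<le> 2 * n\<close>. Adding the two length
bounds gives the degree bound \<open>n * exp (2 * n / e)\<close>, and \<open>n \<ge> 1\<close>.

That dumbbells and even cycles are circuits has two parts. Supports are minimal because a vector in
the kernel of the incidence matrix that is supported on the graph and vanishes on one of its edges
vanishes on all of them (\<open>rigid_circuit\<close>). The binomial is irreducible because some variable occurs
in it exactly once and to the first power (\<open>irreducible_mon_diff\<close>).
\<close>

section \<open>Alternating closed walks\<close>

fun walk_edges :: "'v list \<Rightarrow> 'v set list" where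
  "walk_edges (x # y # zs) = {x, y} # walk_edges (y # zs)"
| "walk_edges xs = []"

lemma walk_edges_append: "walk_edges (xs @ y # ys) = walk_edges (xs @ [y]) @ walk_edges (y # ys)"
  by (induction xs rule: walk_edges.induct) auto

lemma length_walk_edges [simp]: "length (walk_edges xs) = length xs - 1"
  by (induction xs rule: walk_edges.induct) auto

lemma walk_edges_rev: "walk_edges (rev xs) = rev (walk_edges xs)"
proof (induction xs rule: walk_edges.induct)
  case (1 x y zs)
  have "walk_edges (rev (x # y # zs)) = walk_edges (rev zs @ [y]) @ walk_edges [y, x]"
    using walk_edges_append[of "rev zs" y "[x]"] by simp
  with 1 show ?case by (simp add: insert_commute)
qed auto

lemma walk_edges_subset: "e \<in> set (walk_edges xs) \<Longrightarrow> e \<subseteq> set xs"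
  by (induction xs rule: walk_edges.induct) auto

text \<open>
For the edge list of a walk these are the two colours of its alternating 2-colouring. The order of the
edges is forgotten because only their multiplicities enter the binomial.
\<close>

fun colour_class :: "bool \<Rightarrow> 'a list \<Rightarrow> 'a multiset" where
  "colour_class b [] = {#}"
| "colour_class b (x # xs) = (if b then {#x#} else {#}) + colour_class (\<not> b) xs"

lemma colour_class_append:
  "colour_class b (xs @ ys) = colour_class b xs + colour_class (b = even (length xs)) ys"
proof (induction xs arbitrary: b)
  case (Cons x xs)
  show ?case by (cases b) (simp_all add: Cons)
qed simp

lemma colour_class_rev: "colour_class b (rev xs) = colour_class (b = odd (length xs)) xs"
proof (induction xs arbitrary: b)
  case (Cons x xs)
  show ?case by (cases b; cases "even (length xs)") (simp_all add: Cons colour_class_append)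
qed simp

lemma colour_class_union: "colour_class b xs + colour_class (\<not> b) xs = mset xs"
proof (induction xs arbitrary: b)
  case (Cons x xs)
  show ?case using Cons[of True] by (cases b) (simp_all add: add.commute)
qed simp

lemma colour_class_True_False:
  "colour_class True xs + colour_class False xs = mset xs"
  using colour_class_union[of True xs] by simp

definition deg :: "'v set multiset \<Rightarrow> 'v \<Rightarrow> nat" where
  "deg M v = size (filter_mset (\<lambda>e. v \<in> e) M)"

lemma deg_union [simp]: "deg (M + N) v = deg M v + deg N v"
  by (simp add: deg_def)

lemma deg_empty [simp]: "deg {#} v = 0"
  by (simp add: deg_def)

lemma deg_single [simp]: "deg {#e#} v = of_bool (v \<in> e)"
  by (simp add: deg_def)

text \<open>
The vertex-\<open>v\<close> entry of the incidence matrix applied to the alternating sum of the edges, the first edge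
having positive sign if \<open>b\<close> holds.
\<close>

definition excess :: "bool \<Rightarrow> 'v set list \<Rightarrow> 'v \<Rightarrow> int" where
  "excess b es v = int (deg (colour_class b es) v) - int (deg (colour_class (\<not> b) es) v)"

lemma excess_append:
  "excess b (es @ fs) v = excess b es v + excess (b = even (length es)) fs v"
  by (cases b; cases "even (length es)") (simp_all add: excess_def colour_class_append)

text \<open>
Consecutive edges have opposite colours, so their contributions at the common vertex cancel and only
the two ends of the walk remain.
\<close>

lemma excess_walk:
  assumes "successively (\<noteq>) xs" "xs \<noteq> []"
  shows "excess b (walk_edges xs) v =
    (if b then 1 else -1) * (of_bool (v = hd xs) - (-1) ^ (length xs - 1) * of_bool (v = last xs))"
  using assms
proof (induction xs arbitrary: b rule: walk_edges.induct)
  case (1 x y zs)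
  have "excess b (walk_edges (x # y # zs)) v = excess b [{x, y}] v + excess (\<not> b) (walk_edges (y # zs)) v"
    using excess_append[of b "[{x, y}]" "walk_edges (y # zs)" v] by simp
  also have "excess b [{x, y}] v = (if b then 1 else -1) * (of_bool (v = x) + of_bool (v = y))"
    using 1 by (auto simp: excess_def)
  finally have *: "excess b (walk_edges (x # y # zs)) v =
    (if b then 1 else -1) * (of_bool (v = x) + of_bool (v = y)) + excess (\<not> b) (walk_edges (y # zs)) v" .
  have "excess (\<not> b) (walk_edges (y # zs)) v = (if b then -1 else 1) *
    (of_bool (v = y) - (-1) ^ length zs * of_bool (v = last (y # zs)))"
    using 1 by simp
  thus ?case unfolding * by (cases b) (simp_all add: algebra_simps del: walk_edges.simps)
qed (auto simp: excess_def)

definition balanced :: "'v set multiset \<Rightarrow> 'v set multiset \<Rightarrow> bool" where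
  "balanced R B \<longleftrightarrow> (\<forall>v. deg R v = deg B v)"

lemma balanced_iff_excess:
  "balanced (colour_class b es) (colour_class (\<not> b) es) \<longleftrightarrow> (\<forall>v. excess b es v = 0)"
  by (auto simp: balanced_def excess_def)

text \<open>
The combinatorial form of primitivity. Comparing the sums \<open>R + B\<close> rather than the pairs is no loss:
\<open>R + B = P + N\<close> with \<open>R \<subseteq># P\<close> and \<open>B \<subseteq># N\<close> forces \<open>R = P\<close> and \<open>B = N\<close>.
\<close>

definition primitive_pair :: "'v set multiset \<Rightarrow> 'v set multiset \<Rightarrow> bool" where
  "primitive_pair P N \<longleftrightarrow> balanced P N \<and>
     (\<forall>R B. R \<subseteq># P \<longrightarrow> B \<subseteq># N \<longrightarrow> balanced R B \<longrightarrow> R + B = {#} \<or> R + B = P + N)"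

lemma primitive_pair_commute: "primitive_pair P N \<longleftrightarrow> primitive_pair N P"
  unfolding primitive_pair_def balanced_def by (metis add.commute)

lemma primitive_pairD:
  "primitive_pair P N \<Longrightarrow> R \<subseteq># P \<Longrightarrow> B \<subseteq># N \<Longrightarrow> balanced R B \<Longrightarrow> R + B = {#} \<or> R + B = P + N"
  by (auto simp: primitive_pair_def)

lemma balanced_diff:
  assumes "balanced P N" "R \<subseteq># P" "B \<subseteq># N"
  shows "int (deg (P - R) v) - int (deg (N - B) v) = int (deg B v) - int (deg R v)"
proof -
  have "deg P v = deg (P - R) v + deg R v" "deg N v = deg (N - B) v + deg B v"
    using assms by (metis deg_union subset_mset.diff_add)+
  thus ?thesis using assms by (simp add: balanced_def)
qed

lemma deg_pos_obtain: assumes "deg M v > 0" obtains e where "e \<in># M" "v \<in> e"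
proof -
  from assms have "filter_mset (\<lambda>e. v \<in> e) M \<noteq> {#}" by (metis deg_def size_empty less_irrefl)
  then obtain e where "e \<in># filter_mset (\<lambda>e. v \<in> e) M" by (meson multiset_nonemptyE)
  thus thesis using that by auto
qed

definition trail :: "'v set multiset \<Rightarrow> 'v set multiset \<Rightarrow> 'v list \<Rightarrow> bool" where
  "trail P N w \<longleftrightarrow> w \<noteq> [] \<and> successively (\<noteq>) w \<and>
     colour_class True (walk_edges w) \<subseteq># P \<and> colour_class False (walk_edges w) \<subseteq># N"

lemma trail_length: assumes "trail P N w" shows "length w \<le> size P + size N + 1"
proof -
  have "size (colour_class True (walk_edges w)) + size (colour_class False (walk_edges w)) = length w - 1"
    unfolding size_union[symmetric] colour_class_True_False by simp
  moreover have "size (colour_class True (walk_edges w)) \<le> size P" "size (colour_class False (walk_edges w)) \<le> size N"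
    using assms by (auto simp: trail_def size_mset_mono)
  ultimately show ?thesis by linarith
qed

text \<open>
A trail that is not an even closed walk has nonzero excess at its last vertex. Since \<open>P\<close> and \<open>N\<close> are
balanced, the unused edges have the opposite excess there, so an unused edge of the colour that is due
next leaves that vertex.
\<close>

lemma trail_extend:
  assumes "trail P N w" "balanced P N" "\<forall>e \<in># P + N. card e = 2"
    and "\<not> (hd w = last w \<and> odd (length w))"
    and "length w \<ge> 2"
  shows "\<exists>y. trail P N (w @ [y])"
proof -
  define b where "b = odd (length w)"
  define E where "E = walk_edges w"
  define X where "X = (if b then P - colour_class True E else N - colour_class False E)"
  let ?z = "last w"
  have w: "w \<noteq> []" "successively (\<noteq>) w" "colour_class True E \<subseteq># P" "colour_class False E \<subseteq># N"
    using assms by (auto simp: trail_def E_def)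
  have ex: "excess True E ?z = of_bool (?z = hd w) - (-1) ^ (length w - 1)"
    unfolding E_def using excess_walk[OF w(2,1), of True ?z] by simp
  have "int (deg (P - colour_class True E) ?z) - int (deg (N - colour_class False E) ?z) = - excess True E ?z"
    using balanced_diff[OF assms(2) w(3,4), of ?z] by (simp add: excess_def)
  hence "deg X ?z > 0"
    using ex assms(4) w(1) by (cases "length w") (auto simp: X_def b_def of_bool_def split: if_splits)
  then obtain e where e: "e \<in># X" "?z \<in> e" by (rule deg_pos_obtain)
  have "e \<in># P + N" using e by (auto simp: X_def split: if_splits dest: in_diffD)
  hence "card e = 2" using assms(3) by blast
  then obtain y where y: "e = {?z, y}" "y \<noteq> ?z"
    using e(2) by (metis card_2_iff doubleton_eq_iff insert_iff singletonD)
  have we: "walk_edges (w @ [y]) = E @ [{?z, y}]"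
  proof -
    have "w @ [y] = butlast w @ ?z # [y]" using w(1) by simp
    also have "walk_edges \<dots> = walk_edges (butlast w @ [?z]) @ walk_edges [?z, y]" by (rule walk_edges_append)
    finally show ?thesis using w(1) by (simp add: E_def)
  qed
  have "trail P N (w @ [y])"
    unfolding trail_def
  proof (intro conjI)
    show "successively (\<noteq>) (w @ [y])" using w y by (auto simp: successively_append_iff)
    have l: "even (length E) = b" using w(1) by (cases w) (auto simp: E_def b_def)
    have add: "A + {#e#} \<subseteq># B" if "A \<subseteq># B" "e \<in># B - A" for A B
      using that by (metis mset_subset_eq_single subset_mset.le_diff_conv2 add.commute)
    show "colour_class True (walk_edges (w @ [y])) \<subseteq># P" "colour_class False (walk_edges (w @ [y])) \<subseteq># N"
      using w(3,4) l e(1) add[OF w(3)] add[OF w(4)]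
      unfolding we colour_class_append X_def y(1) by (cases b; simp)+
  qed auto
  thus ?thesis by blast
qed

lemma primitive_pair_closed_walk:
  assumes "primitive_pair P N" "\<forall>e \<in># P + N. card e = 2" "P \<noteq> {#}"
  obtains w where "length w \<ge> 2" "successively (\<noteq>) w" "hd w = last w" "odd (length w)"
    "colour_class True (walk_edges w) = P" "colour_class False (walk_edges w) = N"
proof -
  obtain e where e: "e \<in># P" using assms(3) by (meson multiset_nonemptyE)
  then obtain x y where xy: "e = {x, y}" "x \<noteq> y" using assms(2) by (metis card_2_iff union_iff)
  have bal: "balanced P N" using assms by (simp add: primitive_pair_def)
  let ?Q = "\<lambda>w. trail P N w \<and> length w \<ge> 2"
  have Q0: "?Q [x, y]" using e xy by (auto simp: trail_def)
  have bd: "\<forall>w. ?Q w \<longrightarrow> length w < size P + size N + 2" using trail_length by fastforce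
  obtain w where w: "?Q w" and mx: "\<forall>w'. ?Q w' \<longrightarrow> length w' \<le> length w"
    using ex_has_greatest_nat[of ?Q "[x,y]" length, OF Q0 bd] by blast
  have closed: "hd w = last w" "odd (length w)"
  proof -
    have "hd w = last w \<and> odd (length w)"
    proof (rule ccontr)
      assume "\<not> ?thesis"
      then obtain y where "trail P N (w @ [y])" using trail_extend[of P N w] w bal assms(2) by blast
      with mx w have "length (w @ [y]) \<le> length w" by (metis le_Suc_eq length_append_singleton)
      thus False by simp
    qed
    thus "hd w = last w" "odd (length w)" by auto
  qed
  let ?R = "colour_class True (walk_edges w)" and ?B = "colour_class False (walk_edges w)"
  have s: "?R \<subseteq># P" "?B \<subseteq># N" "successively (\<noteq>) w" "w \<noteq> []" using w by (auto simp: trail_def)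
  have "balanced ?R ?B"
    using balanced_iff_excess[of True "walk_edges w"] excess_walk[OF s(3,4), of True] closed by simp
  moreover have "?R + ?B \<noteq> {#}"
  proof -
    have "walk_edges w \<noteq> []" using w by (cases w rule: walk_edges.cases) auto
    thus ?thesis by (simp add: colour_class_True_False)
  qed
  ultimately have whole: "?R + ?B = P + N" using primitive_pairD[OF assms(1) s(1,2)] by blast
  obtain X Y where "P = ?R + X" "N = ?B + Y" using s(1,2) by (auto simp: mset_subset_eq_exists_conv)
  with whole have "?R = P" "?B = N" by (simp_all add: ac_simps)
  thus thesis using that w s closed by blast
qed

section \<open>Repeated vertices of a primitive walk\<close>

text \<open>
A primitive walk lists its first vertex again at the end. Nothing is said about which of the two colours
is the positive one, so that the notion is invariant under rotation.
\<close>

definition primitive_walk :: "'v list \<Rightarrow> bool" where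
  "primitive_walk w \<longleftrightarrow> successively (\<noteq>) w \<and> length w \<ge> 2 \<and> hd w = last w \<and> odd (length w) \<and>
     primitive_pair (colour_class True (walk_edges w)) (colour_class False (walk_edges w))"

text \<open>
The form in which primitivity is used: a balanced nonempty selection of edges avoiding some part \<open>B\<close> of the walk
can exist only if \<open>B\<close> is empty.
\<close>

lemma primitive_walk_subwalks:
  assumes w: "primitive_walk w" and AB: "A + B = mset (walk_edges w)"
    and sub: "R \<subseteq># colour_class True (walk_edges w)" "S \<subseteq># colour_class False (walk_edges w)"
    and bal: "balanced R S" and RS: "R + S \<subseteq># A" "R + S \<noteq> {#}"
  shows "B = {#}"
proof -
  have "R + S = mset (walk_edges w)"
    using w primitive_pairD[OF _ sub bal] RS(2) colour_class_True_False[of "walk_edges w"]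
    unfolding primitive_walk_def by metis
  hence "A + B \<subseteq># A" using AB RS(1) by metis
  thus ?thesis by (metis add.right_neutral subset_mset.add_le_cancel_left subset_mset.le_zero_eq)
qed

lemma walk_edges_eq_Nil_iff: "walk_edges xs = [] \<longleftrightarrow> length xs \<le> 1"
  by (induction xs rule: walk_edges.induct) auto

text \<open>
The piece between the two occurrences is an even closed walk, hence balanced, hence everything.
\<close>

lemma primitive_walk_repeat:
  assumes "primitive_walk w" "w = as @ y # bs @ y # cs" "odd (length bs)"
  shows "as = [] \<and> cs = []"
proof -
  define E1 E2 E3 where "E1 = walk_edges (as @ [y])" and "E2 = walk_edges (y # bs @ [y])" and "E3 = walk_edges (y # cs)"
  have E: "walk_edges w = E1 @ E2 @ E3"
    unfolding assms(2) E1_def E2_def E3_def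
    using walk_edges_append[of as y "bs @ y # cs"] walk_edges_append[of "y # bs" y cs] by simp
  have E2: "even (length E2)" "E2 \<noteq> []" using assms(3) by (auto simp: E2_def walk_edges_eq_Nil_iff)
  define c where "c = even (length E1)"
  have "successively (\<noteq>) (as @ (y # bs @ [y]) @ cs)" using assms by (simp add: primitive_walk_def)
  hence s: "successively (\<noteq>) (y # bs @ [y])" by (simp only: successively_append_iff)
  have "balanced (colour_class c E2) (colour_class (\<not> c) E2)"
    unfolding balanced_iff_excess E2_def using excess_walk[OF s, of c] assms(3) by simp
  moreover have "colour_class c E2 \<subseteq># colour_class True (walk_edges w)"
    "colour_class (\<not> c) E2 \<subseteq># colour_class False (walk_edges w)"
    unfolding E colour_class_append using E2 by (auto simp: c_def)
  ultimately have "mset (E1 @ E3) = {#}"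
    using primitive_walk_subwalks[OF assms(1), of "mset E2" "mset (E1 @ E3)" "colour_class c E2" "colour_class (\<not> c) E2"]
      E2 by (simp add: E colour_class_union)
  thus ?thesis by (simp add: E1_def E3_def walk_edges_eq_Nil_iff)
qed

text \<open>
The occurrences of \<open>y\<close> and of \<open>z\<close> are an odd number of steps apart. Hence the two pieces that lead
from \<open>y\<close> to \<open>z\<close> have lengths of equal parity but start in opposite colours, and their excesses cancel.
They are a balanced selection that leaves out the nonempty piece from \<open>z\<close> back to \<open>y\<close>.
\<close>

lemma primitive_walk_no_crossing:
  assumes "primitive_walk w" "w = as @ y # bs @ z # cs @ y # ds @ z # es"
  shows False
proof -
  define E1 E2 E3 E4 E5 where "E1 = walk_edges (as @ [y])" and "E2 = walk_edges (y # bs @ [z])"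
    and "E3 = walk_edges (z # cs @ [y])" and "E4 = walk_edges (y # ds @ [z])" and "E5 = walk_edges (z # es)"
  note Es = E1_def E2_def E3_def E4_def E5_def
  have E: "walk_edges w = E1 @ E2 @ E3 @ E4 @ E5"
    unfolding assms(2) Es
    using walk_edges_append[of as y "bs @ z # cs @ y # ds @ z # es"]
      walk_edges_append[of "y # bs" z "cs @ y # ds @ z # es"]
      walk_edges_append[of "z # cs" y "ds @ z # es"] walk_edges_append[of "y # ds" z "es"] by simp
  have 1: "even (length (bs @ z # cs))"
    using primitive_walk_repeat[OF assms(1), of as y "bs @ z # cs" "ds @ z # es"] assms(2) by auto
  have 2: "even (length (cs @ y # ds))"
    using primitive_walk_repeat[OF assms(1), of "as @ y # bs" z "cs @ y # ds" "es"] assms(2) by auto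
  have s: "successively (\<noteq>) (y # bs @ [z])" "successively (\<noteq>) (y # ds @ [z])"
  proof -
    have "successively (\<noteq>) (as @ (y # bs @ [z]) @ cs @ (y # ds @ [z]) @ es)"
      using assms by (simp add: primitive_walk_def)
    thus "successively (\<noteq>) (y # bs @ [z])" "successively (\<noteq>) (y # ds @ [z])" by (simp_all only: successively_append_iff)
  qed
  define c where "c = even (length E1)"
  have l: "length E2 = Suc (length bs)" "length E3 = Suc (length cs)" "length E4 = Suc (length ds)"
    by (simp_all add: Es)
  let ?R = "colour_class c E2 + colour_class (\<not> c) E4" and ?S = "colour_class (\<not> c) E2 + colour_class c E4"
  have "excess c E2 v + excess (\<not> c) E4 v = 0" for v
    unfolding Es using excess_walk[OF s(1), of c v] excess_walk[OF s(2), of "\<not> c" v] 1 2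
    by (cases "even (length bs)"; cases "even (length ds)"; cases c) auto
  hence "balanced ?R ?S" by (simp add: balanced_def excess_def algebra_simps flip: of_nat_add)
  moreover have "?R \<subseteq># colour_class True (walk_edges w)" "?S \<subseteq># colour_class False (walk_edges w)"
  proof -
    have c: "(True = even (length E1)) = c" "(False = even (length E1)) = (\<not> c)" by (simp_all add: c_def)
    have par: "even (length E2) = odd (length E3)" "even (length E4) = odd (length E3)" using 1 2 by (auto simp: l)
    have "colour_class True (walk_edges w) = ?R + (colour_class True E1 + colour_class (c = even (length E2)) E3 + colour_class (((c = even (length E2)) = even (length E3)) = even (length E4)) E5)"
      unfolding E colour_class_append c by (cases c; cases "even (length E3)") (simp_all add: par ac_simps)
    thus "?R \<subseteq># colour_class True (walk_edges w)" by simp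
    have "colour_class False (walk_edges w) = ?S + (colour_class False E1 + colour_class ((\<not> c) = even (length E2)) E3 + colour_class ((((\<not> c) = even (length E2)) = even (length E3)) = even (length E4)) E5)"
      unfolding E colour_class_append c by (cases c; cases "even (length E3)") (simp_all add: par ac_simps)
    thus "?S \<subseteq># colour_class False (walk_edges w)" by simp
  qed
  moreover have "?R + ?S = mset (E2 @ E4)"
  proof -
    have "?R + ?S = (colour_class c E2 + colour_class (\<not> c) E2) + (colour_class c E4 + colour_class (\<not> c) E4)"
      by (simp add: ac_simps)
    thus ?thesis by (simp only: colour_class_union mset_append)
  qed
  moreover have "mset (E2 @ E4) + mset (E1 @ E3 @ E5) = mset (walk_edges w)" by (simp add: E ac_simps)
  moreover have "mset (E2 @ E4) \<noteq> {#}" using l by auto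
  ultimately have "mset (E1 @ E3 @ E5) = {#}"
    using primitive_walk_subwalks[OF assms(1), of "mset (E2 @ E4)" "mset (E1 @ E3 @ E5)" ?R ?S] by simp
  thus False using l by auto
qed

lemma primitive_walk_rotate:
  assumes "primitive_walk (x # as @ y # bs @ [x])"
  shows "primitive_walk (y # bs @ x # as @ [y])"
proof -
  let ?w = "x # as @ y # bs @ [x]" and ?w' = "y # bs @ x # as @ [y]"
  define E1 E2 where "E1 = walk_edges (x # as @ [y])" and "E2 = walk_edges (y # bs @ [x])"
  have E: "walk_edges ?w = E1 @ E2" "walk_edges ?w' = E2 @ E1"
    using walk_edges_append[of "x # as" y "bs @ [x]"] walk_edges_append[of "y # bs" x "as @ [y]"]
    by (simp_all add: E1_def E2_def)
  have par: "even (length E1) = even (length E2)" using assms by (auto simp: primitive_walk_def E1_def E2_def)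
  have "primitive_pair (colour_class True (E2 @ E1)) (colour_class False (E2 @ E1))"
    using assms par unfolding primitive_walk_def E colour_class_append
    by (cases "even (length E1)") (auto simp: add.commute primitive_pair_commute)
  moreover have "successively (\<noteq>) ?w'"
  proof -
    have "successively (\<noteq>) (((x # as) @ [y]) @ (bs @ [x]))" "successively (\<noteq>) ((x # as) @ ((y # bs) @ [x]))"
      using assms by (simp_all add: primitive_walk_def)
    hence A: "successively (\<noteq>) ((x # as) @ [y])" and B: "successively (\<noteq>) ((y # bs) @ [x])"
      by (simp_all only: successively_append_iff)
    from B have "successively (\<noteq>) (y # bs)" "last (y # bs) \<noteq> x"
      by (simp_all only: successively_append_iff) auto
    hence "successively (\<noteq>) ((y # bs) @ (x # (as @ [y])))"
      using A by (subst successively_append_iff) auto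
    thus ?thesis by simp
  qed
  ultimately show ?thesis using assms E by (auto simp: primitive_walk_def)
qed

text \<open>
The two restrictions on repetitions, in a form that passes to contiguous sublists.
\<close>

definition noncrossing_odd :: "'v list \<Rightarrow> bool" where
  "noncrossing_odd w \<longleftrightarrow>
     (\<forall>as y bs cs. w = as @ y # bs @ y # cs \<longrightarrow> even (length bs)) \<and>
     (\<forall>as y bs z cs ds es. w \<noteq> as @ y # bs @ z # cs @ y # ds @ z # es)"

lemma noncrossing_odd_sub: "noncrossing_odd (us @ w @ vs) \<Longrightarrow> noncrossing_odd w"
  unfolding noncrossing_odd_def
proof (intro conjI allI impI notI, goal_cases)
  case (1 as y bs cs)
  have "us @ w @ vs = (us @ as) @ y # bs @ y # (cs @ vs)" using 1 by simp
  thus ?case using 1(1) by blast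
next
  case (2 as y bs z cs ds es)
  have "us @ w @ vs = (us @ as) @ y # bs @ z # cs @ y # ds @ z # (es @ vs)" using 2 by simp
  thus ?case using 2(1) by blast
qed

text \<open>
Three occurrences would give two odd distances whose sum is also odd.
\<close>

lemma noncrossing_odd_thrice:
  assumes "noncrossing_odd w" "w = as @ y # bs @ y # cs" shows "y \<notin> set bs \<and> y \<notin> set cs"
proof -
  have odd: "\<And>as y bs cs. w = as @ y # bs @ y # cs \<Longrightarrow> even (length bs)"
    using assms(1) unfolding noncrossing_odd_def by blast
  have "y \<notin> set cs"
  proof
    assume "y \<in> set cs"
    then obtain c1 c2 where c: "cs = c1 @ y # c2" by (meson split_list)
    have "even (length bs)" using odd assms(2) by blast
    moreover have "even (length c1)" using odd[of "as @ y # bs" y c1 c2] assms(2) c by simp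
    moreover have "even (length (bs @ y # c1))" using odd[of as y "bs @ y # c1" c2] assms(2) c by simp
    ultimately show False by simp
  qed
  moreover have "y \<notin> set bs"
  proof
    assume "y \<in> set bs"
    then obtain c1 c2 where c: "bs = c1 @ y # c2" by (meson split_list)
    have "even (length bs)" using odd assms(2) by blast
    moreover have "even (length c1)" using odd[of as y c1 "c2 @ y # cs"] assms(2) c by simp
    moreover have "even (length c2)" using odd[of "as @ y # c1" y c2 cs] assms(2) c by simp
    ultimately show False using c by simp
  qed
  ultimately show ?thesis by simp
qed

lemma noncrossing_odd_disjoint:
  assumes "noncrossing_odd w" "w = as @ y # bs @ y # cs" shows "set bs \<inter> set cs = {}"
proof (rule ccontr)
  assume "\<not> ?thesis"
  then obtain z where "z \<in> set bs" "z \<in> set cs" by auto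
  then obtain b1 b2 c1 c2 where "bs = b1 @ z # b2" "cs = c1 @ z # c2" by (meson split_list)
  hence "w = as @ y # b1 @ z # b2 @ y # c1 @ z # c2" using assms(2) by simp
  thus False using assms(1) unfolding noncrossing_odd_def by blast
qed

lemma primitive_walk_noncrossing_odd:
  assumes "primitive_walk w" shows "noncrossing_odd (butlast w)"
  unfolding noncrossing_odd_def
proof (intro conjI allI impI notI, goal_cases)
  have w: "w \<noteq> []" using assms by (auto simp: primitive_walk_def)
  case (1 as y bs cs)
  hence "w = (as @ y # bs @ y # cs) @ [last w]" using w by (metis append_butlast_last_id)
  hence "w = as @ y # bs @ y # (cs @ [last w])" by simp
  thus ?case using primitive_walk_repeat[OF assms] by blast
next
  have w: "w \<noteq> []" using assms by (auto simp: primitive_walk_def)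
  case (2 as y bs z cs ds es)
  hence "w = (as @ y # bs @ z # cs @ y # ds @ z # es) @ [last w]" using w by (metis append_butlast_last_id)
  hence "w = as @ y # bs @ z # cs @ y # ds @ z # (es @ [last w])" by simp
  thus ?case using primitive_walk_no_crossing[OF assms] by blast
qed

text \<open>
If some vertex is repeated, the walk is rotated so that it starts there; its two odd closed pieces are then
visible.
\<close>

lemma primitive_walk_cases:
  assumes "primitive_walk w"
  obtains "distinct (tl w)"
  | x bs cs where "primitive_walk (x # bs @ x # cs @ [x])" "mset (walk_edges (x # bs @ x # cs @ [x])) = mset (walk_edges w)"
proof (cases "distinct (tl w)")
  case False
  then obtain as y bs cs where t: "tl w = as @ [y] @ bs @ [y] @ cs" by (metis not_distinct_decomp)
  have w: "w \<noteq> []" using assms by (auto simp: primitive_walk_def)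
  define x where "x = hd w"
  have wx: "w = x # as @ y # bs @ y # cs" using t w by (metis append_Cons append_Nil list.collapse x_def)
  show ?thesis
  proof (cases cs rule: rev_cases)
    case Nil
    hence "x = y" using assms wx by (auto simp: primitive_walk_def)
    thus ?thesis using that(2)[of y as bs] wx Nil assms by simp
  next
    case (snoc cs' x')
    hence x': "x' = x" using assms wx by (auto simp: primitive_walk_def)
    have wx': "w = x # as @ y # (bs @ y # cs') @ [x]" using wx snoc x' by simp
    have "primitive_walk (y # bs @ y # (cs' @ x # as) @ [y])"
      using primitive_walk_rotate[of x as y "bs @ y # cs'"] assms wx' by simp
    moreover have "mset (walk_edges (y # bs @ y # (cs' @ x # as) @ [y])) = mset (walk_edges w)"
      unfolding wx' using walk_edges_append[of "y # bs @ y # cs'" x "as @ [y]"]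
        walk_edges_append[of "x # as" y "bs @ y # cs' @ [x]"] by simp
    ultimately show ?thesis using that(2) by blast
  qed
qed (rule that(1))

section \<open>Cactus decomposition and long lollipops\<close>

text \<open>
A cactus with branches \<open>c1, ..., cm\<close> at \<open>a\<close> stands for the cycle through \<open>a\<close> and the bases of the \<open>ci\<close>, each
\<open>ci\<close> being attached at its base. A cactus without branches is a plain vertex, to which no further cycle
is attached.
\<close>

datatype 'v cactus = Node (base: 'v) (branches: "'v cactus list")

text \<open>
The closed walk around the cactus, each attached cactus being traversed when its base is reached.
\<close>

fun word :: "'v cactus \<Rightarrow> 'v list" where
  "word (Node a cs) = a # (if cs = [] then [] else concat (map word cs) @ [a])"

fun vertices :: "'v cactus \<Rightarrow> 'v list" where
  "vertices (Node a cs) = a # concat (map vertices cs)"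

text \<open>
All closed walks around subcacti have odd length. The condition is phrased for the part between the
two occurrences of the base, one vertex shorter, so that it also holds for plain vertices.
\<close>

fun odd_cactus :: "'v cactus \<Rightarrow> bool" where
  "odd_cactus (Node a cs) \<longleftrightarrow> even (length (concat (map word cs))) \<and> (\<forall>c \<in> set cs. odd_cactus c)"

lemma set_word: "set (word t) = set (vertices t)"
  by (induction t) auto

lemma word_ends [simp]: "word t \<noteq> []" "hd (word t) = base t" "last (word t) = base t"
  by (cases t; auto)+

lemma word_leaf: "branches t = [] \<Longrightarrow> word t = [base t]"
  by (cases t) simp

lemma base_in_vertices: "base t \<in> set (vertices t)"
  by (cases t) auto

text \<open>
Scan the list from the left. If the first vertex \<open>a\<close> occurs again, it occurs exactly once more; the part
between the two occurrences is the forest attached at \<open>a\<close>, and it shares no vertex with the rest because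
repetitions do not cross. Inequality of neighbours makes that part nonempty, so that \<open>a\<close> really
carries branches.
\<close>

lemma noncrossing_odd_forest:
  assumes "noncrossing_odd w" "successively (\<noteq>) w"
  shows "\<exists>ts. concat (map word ts) = w \<and> (\<forall>t \<in> set ts. odd_cactus t) \<and> distinct (concat (map vertices ts))"
  using assms
proof (induction w rule: length_induct)
  case (1 w)
  have IH: "\<exists>ts. concat (map word ts) = v \<and> (\<forall>t \<in> set ts. odd_cactus t) \<and> distinct (concat (map vertices ts))"
    if "w = us @ v @ vs" "length v < length w" for us v vs
  proof -
    have "noncrossing_odd v" using that 1(2) noncrossing_odd_sub by blast
    moreover have "successively (\<noteq>) v" using that 1(3) by (simp add: successively_append_iff)
    ultimately show ?thesis using 1(1) that(2) by blast
  qed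
  have set_words: "set (concat (map vertices ts)) = set (concat (map word ts))" for ts :: "'a cactus list"
    by (simp add: set_word)
  show ?case
  proof (cases w)
    case Nil
    thus ?thesis by (intro exI[of _ "[]"]) simp
  next
    case (Cons a v)
    show ?thesis
    proof (cases "a \<in> set v")
      case False
      obtain ts where ts: "concat (map word ts) = v" "\<forall>t \<in> set ts. odd_cactus t" "distinct (concat (map vertices ts))"
        using IH[of "[a]" v "[]"] Cons by auto
      show ?thesis using ts False Cons set_words[of ts]
        by (intro exI[of _ "Node a [] # ts"]) simp
    next
      case True
      then obtain bs cs where v: "v = bs @ a # cs" by (meson split_list)
      have w: "w = [] @ a # bs @ a # cs" using v Cons by simp
      have ne: "bs \<noteq> []" using 1(3) w by auto
      have a: "a \<notin> set bs" "a \<notin> set cs" using noncrossing_odd_thrice[OF 1(2) w] by auto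
      have dj: "set bs \<inter> set cs = {}" using noncrossing_odd_disjoint[OF 1(2) w] .
      have ev: "even (length bs)" using 1(2) w unfolding noncrossing_odd_def by blast
      obtain ds where ds: "concat (map word ds) = bs" "\<forall>t \<in> set ds. odd_cactus t" "distinct (concat (map vertices ds))"
        using IH[of "[a]" bs "a # cs"] w by auto
      obtain ts where ts: "concat (map word ts) = cs" "\<forall>t \<in> set ts. odd_cactus t" "distinct (concat (map vertices ts))"
        using IH[of "a # bs @ [a]" cs "[]"] w by auto
      have "ds \<noteq> []" using ds ne by auto
      thus ?thesis using ds ts w ev a dj set_words[of ts] set_words[of ds]
        by (intro exI[of _ "Node a ds # ts"]) simp
    qed
  qed
qed

text \<open>
The word of a cactus starts and ends at its base, so bases of consecutive branches are neighbours in the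
walk. Thus the cycle of a cactus consists of edges of the walk. The flanking lists \<open>us\<close> and \<open>vs\<close>
provide the closing vertex of the cycle and make the induction go through.
\<close>

lemma successively_concat_words:
  assumes "successively R (us @ concat (map word cs) @ vs)"
  shows "successively R (us @ map base cs @ vs)" "\<forall>c \<in> set cs. successively R (word c)"
  using assms
proof (induction cs arbitrary: us)
  case (Cons c cs)
  { case 1
    have "successively R ((us @ word c) @ concat (map word cs) @ vs)" using 1 by simp
    hence "successively R ((us @ word c) @ map base cs @ vs)" using Cons(1) by blast
    thus ?case by (cases "map base cs @ vs") (auto simp: successively_append_iff)
  next
    case 2
    have "successively R ((us @ word c) @ concat (map word cs) @ vs)" using 2 by simp
    hence "\<forall>c \<in> set cs. successively R (word c)" using Cons(2) by blast
    moreover have "successively R (word c)" using 2 by (simp add: successively_append_iff)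
    ultimately show ?case by simp }
qed auto

lemma finite_has_greatest_value:
  fixes h :: "'a \<Rightarrow> nat"
  assumes "finite B" "B \<noteq> {}"
  shows "\<exists>c\<in>B. \<forall>c'\<in>B. h c' \<le> h c"
proof -
  have "Max (h ` B) \<in> h ` B" using assms by (intro Max_in) auto
  then obtain c where "c \<in> B" "h c = Max (h ` B)" by auto
  thus ?thesis using assms by (intro bexI[of _ c]) auto
qed

lemma finite_has_least_value:
  fixes h :: "'a \<Rightarrow> nat"
  assumes "finite B" "B \<noteq> {}"
  shows "\<exists>c\<in>B. \<forall>c'\<in>B. h c \<le> h c'"
  using ex_has_least_nat[of "\<lambda>c. c \<in> B" _ h] assms(2) by blast

text \<open>
A path \<open>p\<close> that starts at \<open>x\<close>, followed by an odd cycle through the last vertex of \<open>p\<close>; the list \<open>c\<close> contains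
the other vertices of the cycle. The path may consist of \<open>x\<close> alone.
\<close>

definition lollipop :: "('v \<Rightarrow> 'v \<Rightarrow> bool) \<Rightarrow> 'v \<Rightarrow> 'v list \<Rightarrow> 'v list \<Rightarrow> bool" where
  "lollipop R x p c \<longleftrightarrow> p \<noteq> [] \<and> hd p = x \<and> distinct (p @ c) \<and> successively R p \<and>
     successively R (last p # c @ [last p]) \<and> c \<noteq> [] \<and> even (length c)"

text \<open>
The length of the closed walk that runs along the path, round the cycle and back.
\<close>

definition lollipop_length :: "'v list \<Rightarrow> 'v list \<Rightarrow> nat" where
  "lollipop_length p c = 2 * (length p - 1) + length c + 1"

lemma le_exp_div_e: "x \<le> exp (x / exp 1)" for x :: real
proof -
  have "x / exp 1 \<le> exp (x / exp 1 - 1)"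
    using exp_ge_add_one_self[of "x / exp 1 - 1"] by simp
  also have "\<dots> = exp (x / exp 1) / exp 1" by (rule exp_diff)
  finally show ?thesis by (simp add: divide_le_cancel)
qed

lemma sum_list_bound: "(\<And>x. x \<in> set xs \<Longrightarrow> f x \<le> b) \<Longrightarrow> sum_list (map f xs) \<le> real (length xs) * b"
  by (induction xs) (auto simp: algebra_simps add_mono)

text \<open>
Induction on the cactus. Let \<open>k\<close> be the length of its cycle and let \<open>M\<close> be the largest lollipop length
among its branches, attained at \<open>c\<close>. Of the two ways round the cycle from \<open>x\<close> to \<open>c\<close>, one has length at least
\<open>k / 2\<close>; prolonging the lollipop of \<open>c\<close> by it gives length at least \<open>k + M\<close>. The closed walk
has length at most \<open>k + (k - 1) * (M * exp (M / e))\<close>, and \<open>k - 1 \<le> exp (k / e)\<close> turns this into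
\<open>(k + M) * exp ((k + M) / e)\<close>. If all branches are plain vertices, the cycle itself is odd and is the
lollipop.
\<close>

lemma cactus_lollipop:
  assumes "branches t \<noteq> []" "odd_cactus t" "distinct (vertices t)" "successively R (word t)" "symp R"
  shows "\<exists>p c. lollipop R (base t) p c \<and> set p \<union> set c \<subseteq> set (vertices t) \<and>
     real (length (word t) - 1) \<le> lollipop_length p c * exp (lollipop_length p c / exp 1)"
  using assms
proof (induction t)
  case (Node x cs)
  have ne: "cs \<noteq> []" using Node by simp
  define k where "k = length cs + 1"
  have s: "successively R (x # concat (map word cs) @ [x])" using Node.prems ne by simp
  have cyc: "successively R (x # map base cs @ [x])"
    using successively_concat_words(1)[of R "[x]" cs "[x]"] s by simp
  have sw: "\<forall>c \<in> set cs. successively R (word c)"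
    using successively_concat_words(2)[of R "[x]" cs "[x]"] s by simp
  have dv: "distinct (concat (map vertices cs))" "x \<notin> set (concat (map vertices cs))" using Node.prems by auto
  have dc: "distinct (vertices c)" if "c \<in> set cs" for c
    using dv(1) that by (auto dest!: split_list)
  have distinct_bases: "distinct (map base cs)" using dv(1)
  proof (induction cs)
    case (Cons c cs)
    have "base c \<noteq> base d" if "d \<in> set cs" for d
      using Cons.prems that base_in_vertices[of c] base_in_vertices[of d] by auto
    thus ?case using Cons by auto
  qed simp
  have base_sub: "base c \<in> set (concat (map vertices cs))" if "c \<in> set cs" for c
    using that base_in_vertices[of c] by auto
  have len: "real (length (word (Node x cs)) - 1) = k + (\<Sum>c\<leftarrow>cs. real (length (word c) - 1))"
  proof -
    have "(\<Sum>c\<leftarrow>cs. real (length (word c))) = (\<Sum>c\<leftarrow>cs. real (length (word c) - 1) + 1)"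
    proof (intro arg_cong[of _ _ sum_list] map_cong refl)
      fix c :: "'a cactus"
      show "real (length (word c)) = real (length (word c) - 1) + 1" by (cases "word c") auto
    qed
    also have "\<dots> = (\<Sum>c\<leftarrow>cs. real (length (word c) - 1)) + length cs" by (induction cs) auto
    finally have *: "(\<Sum>c\<leftarrow>cs. real (length (word c))) = (\<Sum>c\<leftarrow>cs. real (length (word c) - 1)) + length cs" .
    have "real (length (concat (map word cs))) = (\<Sum>c\<leftarrow>cs. real (length (word c)))"
      by (induction cs) auto
    thus ?thesis using * ne by (simp add: k_def)
  qed
  show ?case
  proof (cases "\<forall>c \<in> set cs. branches c = []")
    case True
    have w1: "map word cs = map (\<lambda>c. [base c]) cs" 
    proof (intro map_cong refl)
      fix c assume "c \<in> set cs"
      thus "word c = [base c]" using True word_leaf by auto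
    qed
    have "concat (map (\<lambda>c. [base c]) cs) = map base cs" by (induction cs) auto
    hence w2: "concat (map word cs) = map base cs" by (simp only: w1)
    have ev: "even (length cs)" using Node.prems(2) w2 by simp
    have "lollipop R x [x] (map base cs)"
      unfolding lollipop_def using ne ev cyc distinct_bases dv(2) base_sub by auto
    moreover have "set [x] \<union> set (map base cs) \<subseteq> set (vertices (Node x cs))" using base_sub by auto
    moreover have "real (length (word (Node x cs)) - 1) = real k" using w2 ne by (simp add: k_def)
    moreover have "lollipop_length [x] (map base cs) = k" by (simp add: lollipop_length_def k_def)
    moreover have "real k \<le> real k * exp (real k / exp 1)" by (simp add: mult_le_cancel_left1)
    ultimately show ?thesis by (metis cactus.sel(1))
  next
    case False
    \<comment> \<open>only these branches carry cycles; the induction hypothesis does not apply to plain vertices\<close>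
    define B where "B = {c \<in> set cs. branches c \<noteq> []}"
    have IH: "\<exists>p d. lollipop R (base c) p d \<and> set p \<union> set d \<subseteq> set (vertices c) \<and>
        real (length (word c) - 1) \<le> lollipop_length p d * exp (lollipop_length p d / exp 1)" if "c \<in> B" for c
      using Node.IH[of c] that Node.prems sw dc by (auto simp: B_def)
    then obtain p d where pd: "\<And>c. c \<in> B \<Longrightarrow> lollipop R (base c) (p c) (d c) \<and>
        set (p c) \<union> set (d c) \<subseteq> set (vertices c) \<and>
        real (length (word c) - 1) \<le> lollipop_length (p c) (d c) * exp (lollipop_length (p c) (d c) / exp 1)"
      by metis
    define h where "h c = lollipop_length (p c) (d c)" for c
    have finB: "finite B" "B \<noteq> {}" using False by (auto simp: B_def)
    obtain c where cB: "c \<in> B" and cmax: "\<And>c'. c' \<in> B \<Longrightarrow> h c' \<le> h c"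
      using finite_has_greatest_value[OF finB, of h] by blast
    define M where "M = h c"
    have lp: "lollipop R (base c) (p c) (d c)" and sp: "set (p c) \<union> set (d c) \<subseteq> set (vertices c)"
      using pd[OF cB] by auto
    have "c \<in> set cs" using cB by (simp add: B_def)
    then obtain c1 c2 where cs: "cs = c1 @ c # c2" by (meson split_list)
    have extend: "\<exists>q. lollipop R x q (d c) \<and> set q \<subseteq> set (vertices (Node x cs)) \<and> length q = length rs + 1 + length (p c)"
      if rs: "set rs \<subseteq> set (map base c1) \<union> set (map base c2)" "distinct rs" "successively R (x # rs @ [base c])" for rs
    proof -
      have "base b \<notin> set (vertices c)" if "b \<in> set c1 \<union> set c2" for b
        using dv(1) that base_in_vertices[of b] unfolding cs by auto
      hence r1: "set rs \<inter> set (vertices c) = {}" using rs(1) by auto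
      have rs_sub: "set rs \<subseteq> set (concat (map vertices cs))"
      proof
        fix r assume "r \<in> set rs"
        then obtain b where "b \<in> set c1 \<union> set c2" "r = base b" using rs(1) by auto
        moreover from this have "b \<in> set cs" by (auto simp: cs)
        ultimately show "r \<in> set (concat (map vertices cs))" using base_sub by blast
      qed
      hence r2: "x \<notin> set rs" "x \<notin> set (vertices c)" using dv(2) unfolding cs by auto
      have "lollipop R x (x # rs @ p c) (d c)"
        using lp sp r1 r2 rs(2,3) unfolding lollipop_def
        by (cases "p c") (auto simp: successively_append_iff successively_Cons hd_append split: if_splits)
      moreover have "set (x # rs @ p c) \<subseteq> set (vertices (Node x cs))"
        using sp rs_sub unfolding cs by auto
      ultimately show ?thesis by (intro exI[of _ "x # rs @ p c"]) simp
    qed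
    have e1: "\<exists>q. lollipop R x q (d c) \<and> set q \<subseteq> set (vertices (Node x cs)) \<and> length q = length c1 + 1 + length (p c)"
    proof -
      have "successively R (x # map base c1 @ [base c])"
        using cyc unfolding cs by (auto simp: successively_append_iff successively_Cons hd_append)
      thus ?thesis using extend[of "map base c1"] distinct_bases unfolding cs by simp
    qed
    have e2: "\<exists>q. lollipop R x q (d c) \<and> set q \<subseteq> set (vertices (Node x cs)) \<and> length q = length c2 + 1 + length (p c)"
    proof -
      \<comment> \<open>the other way round the cycle\<close>
      have "successively R (rev (x # map base cs @ [x]))" using cyc \<open>symp R\<close>
        by (subst successively_rev) (auto simp: symp_def elim!: successively_mono)
      hence "successively R ((x # rev (map base c2) @ [base c]) @ (rev (map base c1) @ [x]))" unfolding cs by simp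
      hence "successively R (x # rev (map base c2) @ [base c])" by (simp only: successively_append_iff)
      thus ?thesis using extend[of "rev (map base c2)"] distinct_bases unfolding cs by simp
    qed
    obtain q where q: "lollipop R x q (d c)" "set q \<subseteq> set (vertices (Node x cs))" 
      and ql: "2 * length q \<ge> k + 2 * length (p c)"
    proof (cases "length c1 \<le> length c2")
      case True
      then show ?thesis using e2 that unfolding k_def cs by fastforce
    next
      case False
      then show ?thesis using e1 that unfolding k_def cs by fastforce
    qed
    define H where "H = lollipop_length q (d c)"
    have H: "k + M \<le> H" using ql lp unfolding H_def M_def h_def lollipop_length_def
      by (cases "p c") (auto simp: lollipop_def)
    have child: "real (length (word c') - 1) \<le> M * exp (M / exp 1)" if "c' \<in> set cs" for c'
    proof (cases "branches c' = []")
      case True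
      thus ?thesis by (cases c') simp
    next
      case False
      hence c': "c' \<in> B" using that by (simp add: B_def)
      have "real (length (word c') - 1) \<le> h c' * exp (h c' / exp 1)" using pd[OF c'] by (simp add: h_def)
      also have "\<dots> \<le> M * exp (M / exp 1)" using cmax[OF c'] by (intro mult_mono) (auto simp: M_def divide_right_mono)
      finally show ?thesis .
    qed
    \<comment> \<open>the new cycle contributes \<open>k\<close>, and each of its \<open>k - 1\<close> branches at most the bound for \<open>M\<close>\<close>
    have "real (length (word (Node x cs)) - 1) \<le> k + real (length cs) * (M * exp (M / exp 1))"
      unfolding len by (intro add_left_mono sum_list_bound child)
    also have "\<dots> \<le> k + exp (k / exp 1) * (M * exp (M / exp 1))"
      using le_exp_div_e[of k] by (intro add_left_mono mult_right_mono) (auto simp: k_def)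
    also have "\<dots> = k + M * exp ((k + M) / exp 1)" by (simp add: exp_add add_divide_distrib)
    also have "\<dots> \<le> k * exp ((k + M) / exp 1) + M * exp ((k + M) / exp 1)"
      by (intro add_right_mono) (simp add: mult_le_cancel_left1)
    also have "\<dots> = real (k + M) * exp (real (k + M) / exp 1)" by (simp add: algebra_simps)
    also have "\<dots> \<le> H * exp (H / exp 1)" using H by (intro mult_mono) (auto simp: divide_right_mono)
    finally have "real (length (word (Node x cs)) - 1) \<le> H * exp (H / exp 1)" .
    moreover have "set q \<union> set (d c) \<subseteq> set (vertices (Node x cs))" using q sp by (auto simp: cs)
    ultimately show ?thesis using q(1) unfolding H_def by (metis cactus.sel(1))
  qed
qed

section \<open>Irreducibility of binomials that are linear in a variable\<close>

text \<open>
As in Kronecker substitution, each new variable gets a weight that exceeds all weighted sums over the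
earlier variables; division with remainder by this weight then recovers its exponent.
\<close>

lemma generic_weight:
  fixes K :: "('x \<Rightarrow> nat) set"
  assumes "finite S" "finite K"
  shows "\<exists>W :: 'x \<Rightarrow> nat. \<forall>a \<in> K. \<forall>b \<in> K. (\<Sum>y\<in>S. W y * a y) = (\<Sum>y\<in>S. W y * b y) \<longrightarrow> (\<forall>y\<in>S. a y = b y)"
  using assms(1)
proof induction
  case (insert x S)
  then obtain W where W: "\<forall>a \<in> K. \<forall>b \<in> K. (\<Sum>y\<in>S. W y * a y) = (\<Sum>y\<in>S. W y * b y) \<longrightarrow> (\<forall>y\<in>S. a y = b y)"
    by blast
  define M where "M = Suc (\<Sum>a\<in>K. \<Sum>y\<in>S. W y * a y)"
  have M: "(\<Sum>y\<in>S. W y * a y) < M" if "a \<in> K" for a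
    unfolding M_def using that assms(2) by (intro le_imp_less_Suc member_le_sum) auto
  have eq: "(\<Sum>y\<in>insert x S. (W(x := M)) y * a y) = M * a x + (\<Sum>y\<in>S. W y * a y)" for a
  proof -
    have "(\<Sum>y\<in>S. (W(x := M)) y * a y) = (\<Sum>y\<in>S. W y * a y)" using insert by (intro sum.cong) auto
    thus ?thesis using insert by simp
  qed
  show ?case
  proof (intro exI[of _ "W(x := M)"] ballI impI)
    fix a b y assume ab: "a \<in> K" "b \<in> K"
      and e: "(\<Sum>y\<in>insert x S. (W(x := M)) y * a y) = (\<Sum>y\<in>insert x S. (W(x := M)) y * b y)"
      and y: "y \<in> insert x S"
    let ?s = "\<lambda>a. \<Sum>y\<in>S. W y * a y"
    have e': "M * a x + ?s a = M * b x + ?s b" using e unfolding eq .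
    have "?s a = (M * a x + ?s a) mod M" "?s b = (M * b x + ?s b) mod M"
      "a x = (M * a x + ?s a) div M" "b x = (M * b x + ?s b) div M"
      using M[OF ab(1)] M[OF ab(2)] by auto
    hence "?s a = ?s b" "a x = b x" unfolding e' by simp_all
    thus "a y = b y" using W ab y by auto
  qed
qed simp

text \<open>
A monomial that arises in only one way as a product of terms cannot cancel.
\<close>

lemma keys_mult_unique:
  fixes p q :: "('x, 'k::field) mpoly"
  assumes "a \<in> Poly_Mapping.keys p" "b \<in> Poly_Mapping.keys q"
    and "\<And>a' b'. a' \<in> Poly_Mapping.keys p \<Longrightarrow> b' \<in> Poly_Mapping.keys q \<Longrightarrow> a' + b' = a + b \<Longrightarrow> a' = a \<and> b' = b"
  shows "a + b \<in> Poly_Mapping.keys (p * q)"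
proof -
  define p0 q0 where "p0 = Poly_Mapping.single a (Poly_Mapping.lookup p a)" and "q0 = Poly_Mapping.single b (Poly_Mapping.lookup q b)"
  define p' q' where "p' = p - p0" and "q' = q - q0"
  have kp: "Poly_Mapping.keys p' \<subseteq> Poly_Mapping.keys p - {a}" "Poly_Mapping.keys q' \<subseteq> Poly_Mapping.keys q - {b}"
    by (auto simp: p'_def q'_def p0_def q0_def in_keys_iff lookup_minus lookup_single when_def split: if_splits)
  have "p * q = (p0 + p') * (q0 + q')" by (simp add: p'_def q'_def)
  also have "\<dots> = p0 * q0 + (p' * q + p0 * q')" by (simp add: algebra_simps p'_def q'_def)
  finally have pq: "p * q = p0 * q0 + (p' * q + p0 * q')" .
  have "a + b \<notin> Poly_Mapping.keys (p' * q)"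
  proof
    assume "a + b \<in> Poly_Mapping.keys (p' * q)"
    from subsetD[OF keys_mult this] obtain a' b' where "a + b = a' + b'" "a' \<in> Poly_Mapping.keys p'" "b' \<in> Poly_Mapping.keys q"
      by blast
    with kp(1) assms(3)[of a' b'] show False by auto
  qed
  moreover have "a + b \<notin> Poly_Mapping.keys (p0 * q')"
  proof
    assume "a + b \<in> Poly_Mapping.keys (p0 * q')"
    from subsetD[OF keys_mult this] obtain a' b' where "a + b = a' + b'" "a' \<in> Poly_Mapping.keys p0" "b' \<in> Poly_Mapping.keys q'"
      by blast
    with kp(2) assms(1) assms(3)[of a' b'] show False by (auto simp: p0_def split: if_splits)
  qed
  moreover have "Poly_Mapping.lookup (p0 * q0) (a + b) = Poly_Mapping.lookup p a * Poly_Mapping.lookup q b"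
    by (simp add: p0_def q0_def mult_single)
  ultimately show ?thesis using assms(1,2) unfolding pq in_keys_iff by (simp add: lookup_add)
qed

text \<open>
\<open>A\<close> and \<open>B\<close> play the role of faces of the two Newton polytopes whose sum is a face of the Newton
polytope of the product. A generic weight has a unique maximum and a unique minimum on each of them, and
the sums of the two maxima and of the two minima are uniquely represented, so they survive in the
product. If the product has only one monomial on the face, maximum and minimum agree.
\<close>

lemma face_of_product:
  fixes p q :: "('x, 'k::field) mpoly"
  assumes A: "A \<subseteq> Poly_Mapping.keys p" "A \<noteq> {}" and B: "B \<subseteq> Poly_Mapping.keys q" "B \<noteq> {}"
    and face: "\<And>a b a' b'. a \<in> A \<Longrightarrow> b \<in> B \<Longrightarrow> a' \<in> Poly_Mapping.keys p \<Longrightarrow> b' \<in> Poly_Mapping.keys q \<Longrightarrow>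
      a' + b' = a + b \<Longrightarrow> a' \<in> A \<and> b' \<in> B"
  shows "\<exists>a\<in>A. \<exists>b\<in>B. a + b \<in> Poly_Mapping.keys (p * q)"
    and "(\<And>a b. a \<in> A \<Longrightarrow> b \<in> B \<Longrightarrow> a + b \<in> Poly_Mapping.keys (p * q) \<Longrightarrow> a + b = s) \<Longrightarrow> \<exists>b. B = {b}"
proof -
  define K where "K = A \<union> B"
  have finA: "finite A" and finB: "finite B" using A B finite_keys finite_subset by blast+
  define S where "S = \<Union>(Poly_Mapping.keys ` K)"
  have finK: "finite (Poly_Mapping.lookup ` K)" "finite S" using finA finB by (auto simp: K_def S_def)
  obtain W where W: "\<forall>a \<in> Poly_Mapping.lookup ` K. \<forall>b \<in> Poly_Mapping.lookup ` K.
      (\<Sum>y\<in>S. W y * a y) = (\<Sum>y\<in>S. W y * b y) \<longrightarrow> (\<forall>y\<in>S. a y = b y)"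
    using generic_weight[OF finK(2,1)] by blast
  define wt where "wt a = (\<Sum>y\<in>S. W y * Poly_Mapping.lookup a y)" for a :: "'x \<Rightarrow>\<^sub>0 nat"
  have add: "wt (a + b) = wt a + wt b" for a b
    by (simp add: wt_def lookup_add algebra_simps sum.distrib)
  have inj: "a = b" if "a \<in> K" "b \<in> K" "wt a = wt b" for a b
  proof (rule poly_mapping_eqI)
    fix y
    show "Poly_Mapping.lookup a y = Poly_Mapping.lookup b y"
    proof (cases "y \<in> S")
      case True
      thus ?thesis
        using bspec[OF bspec[OF W imageI[OF that(1)]] imageI[OF that(2)]] that(3) unfolding wt_def by blast
    next
      case False
      thus ?thesis using that by (auto simp: S_def in_keys_iff)
    qed
  qed
  obtain a1 where a1: "a1 \<in> A" "\<And>a. a \<in> A \<Longrightarrow> wt a \<le> wt a1"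
    using finite_has_greatest_value[OF finA A(2), of wt] by blast
  obtain b1 where b1: "b1 \<in> B" "\<And>a. a \<in> B \<Longrightarrow> wt a \<le> wt b1"
    using finite_has_greatest_value[OF finB B(2), of wt] by blast
  obtain a0 where a0: "a0 \<in> A" "\<And>a. a \<in> A \<Longrightarrow> wt a0 \<le> wt a"
    using finite_has_least_value[OF finA A(2), of wt] by blast
  obtain b0 where b0: "b0 \<in> B" "\<And>a. a \<in> B \<Longrightarrow> wt b0 \<le> wt a"
    using finite_has_least_value[OF finB B(2), of wt] by blast
  have key1: "a1 + b1 \<in> Poly_Mapping.keys (p * q)"
  proof (rule keys_mult_unique)
    fix a' b' assume "a' \<in> Poly_Mapping.keys p" "b' \<in> Poly_Mapping.keys q" and e: "a' + b' = a1 + b1"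
    hence ab: "a' \<in> A" "b' \<in> B" using face a1(1) b1(1) by blast+
    have "wt a' + wt b' = wt a1 + wt b1" using e add by metis
    hence "wt a' = wt a1" "wt b' = wt b1" using a1(2)[OF ab(1)] b1(2)[OF ab(2)] by linarith+
    thus "a' = a1 \<and> b' = b1"
      using inj[of a' a1] inj[of b' b1] ab a1(1) b1(1) by (simp add: K_def)
  qed (use a1 b1 A B in auto)
  have key0: "a0 + b0 \<in> Poly_Mapping.keys (p * q)"
  proof (rule keys_mult_unique)
    fix a' b' assume "a' \<in> Poly_Mapping.keys p" "b' \<in> Poly_Mapping.keys q" and e: "a' + b' = a0 + b0"
    hence ab: "a' \<in> A" "b' \<in> B" using face a0(1) b0(1) by blast+
    have "wt a' + wt b' = wt a0 + wt b0" using e add by metis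
    hence "wt a' = wt a0" "wt b' = wt b0" using a0(2)[OF ab(1)] b0(2)[OF ab(2)] by linarith+
    thus "a' = a0 \<and> b' = b0"
      using inj[of a' a0] inj[of b' b0] ab a0(1) b0(1) by (simp add: K_def)
  qed (use a0 b0 A B in auto)
  show "\<exists>a\<in>A. \<exists>b\<in>B. a + b \<in> Poly_Mapping.keys (p * q)" using key1 a1 b1 by blast
  assume s: "\<And>a b. a \<in> A \<Longrightarrow> b \<in> B \<Longrightarrow> a + b \<in> Poly_Mapping.keys (p * q) \<Longrightarrow> a + b = s"
  have "a1 + b1 = a0 + b0" using s key1 key0 a1(1) b1(1) a0(1) b0(1) by metis
  hence "wt a1 + wt b1 = wt a0 + wt b0" using add by metis
  hence "wt b1 = wt b0" using a1(2)[OF a0(1)] b1(2)[OF b0(1)] by linarith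
  hence wb: "wt b = wt b1" if "b \<in> B" for b using b1(2)[OF that] b0(2)[OF that] by linarith
  have "b = b1" if "b \<in> B" for b using inj[of b b1] wb[OF that] that b1(1) by (simp add: K_def)
  hence "B = {b1}" using b1(1) by blast
  thus "\<exists>b. B = {b}" by blast
qed

lemma keys_mon_diff:
  assumes "u \<noteq> v"
  shows "Poly_Mapping.keys (mon u - mon v :: ('x, 'k::field) mpoly) = {u, v}"
    and "Poly_Mapping.lookup (mon u - mon v :: ('x, 'k) mpoly) u = 1"
    and "Poly_Mapping.lookup (mon u - mon v :: ('x, 'k) mpoly) v = - 1"
  using assms by (auto simp: mon_def in_keys_iff lookup_minus lookup_single when_def split: if_splits)

lemma single_unit:
  assumes "c \<noteq> 0" shows "(Poly_Mapping.single 0 c :: ('x, 'k::field) mpoly) dvd 1"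
proof -
  have "(Poly_Mapping.single 0 c :: ('x, 'k) mpoly) * Poly_Mapping.single 0 (inverse c) = 1"
    using assms by (simp add: mult_single)
  thus ?thesis by (metis dvd_triv_left)
qed

text \<open>
The terms of \<open>p\<close> that are linear in \<open>x\<close>, multiplied by \<open>q\<close>, must give the single monomial \<open>u\<close>, so \<open>q\<close> is a
monomial. It divides both \<open>u\<close> and \<open>v\<close>, which are coprime.
\<close>

lemma linear_factor_unit:
  fixes p q :: "('x, 'k::field) mpoly"
  assumes pq: "p * q = mon u - mon v" and "Poly_Mapping.keys u \<inter> Poly_Mapping.keys v = {}"
    and x: "Poly_Mapping.lookup u x = 1"
    and q0: "\<And>b. b \<in> Poly_Mapping.keys q \<Longrightarrow> Poly_Mapping.lookup b x = 0"
  shows "q dvd 1"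
proof -
  have vx: "Poly_Mapping.lookup v x = 0" using assms(2) x by (metis disjoint_iff in_keys_iff zero_neq_one)
  hence uv: "u \<noteq> v" using x by auto
  have k: "Poly_Mapping.keys (p * q) = {u, v}" unfolding pq by (rule keys_mon_diff[OF uv])
  define A where "A = {a \<in> Poly_Mapping.keys p. Poly_Mapping.lookup a x = 1}"
  obtain a b where ab: "u = a + b" "a \<in> Poly_Mapping.keys p" "b \<in> Poly_Mapping.keys q"
    using subsetD[OF keys_mult, of u p q] k by auto
  have "Poly_Mapping.lookup a x = 1" using x q0[OF ab(3)] ab(1) by (simp add: lookup_add)
  hence A: "A \<noteq> {}" "A \<subseteq> Poly_Mapping.keys p" using ab by (auto simp: A_def)
  have "\<exists>b. Poly_Mapping.keys q = {b}"
  proof (rule face_of_product(2)[OF A(2,1), of _ q])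
    fix a b a' b' assume "a \<in> A" "b \<in> Poly_Mapping.keys q" "a' \<in> Poly_Mapping.keys p"
      "b' \<in> Poly_Mapping.keys q" "a' + b' = a + b"
    hence "Poly_Mapping.lookup (a' + b') x = Poly_Mapping.lookup (a + b) x" by simp
    thus "a' \<in> A \<and> b' \<in> Poly_Mapping.keys q"
      using \<open>a \<in> A\<close> q0 \<open>b \<in> _\<close> \<open>b' \<in> _\<close> \<open>a' \<in> _\<close> by (simp add: A_def lookup_add)
  next
    fix a b assume "a \<in> A" "b \<in> Poly_Mapping.keys q" "a + b \<in> Poly_Mapping.keys (p * q)"
    moreover from this have "Poly_Mapping.lookup (a + b) x = 1" using q0 by (simp add: A_def lookup_add)
    ultimately show "a + b = u" using k vx by force
  qed (use ab in auto)
  then obtain d where d: "Poly_Mapping.keys q = {d}" by blast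
  have "v \<in> Poly_Mapping.keys (p * q)" using k by simp
  from subsetD[OF keys_mult this] obtain a' where a': "v = a' + d" using d by auto
  have "d = 0"
  proof (rule poly_mapping_eqI)
    fix y
    have "Poly_Mapping.lookup u y = 0 \<or> Poly_Mapping.lookup v y = 0" using assms(2) by (auto simp: in_keys_iff)
    thus "Poly_Mapping.lookup d y = Poly_Mapping.lookup 0 y"
      using a' ab d by (auto simp: lookup_add)
  qed
  hence "q = Poly_Mapping.single 0 (Poly_Mapping.lookup q 0)"
  proof (intro poly_mapping_eqI)
    fix y
    show "Poly_Mapping.lookup q y = Poly_Mapping.lookup (Poly_Mapping.single 0 (Poly_Mapping.lookup q 0)) y"
      using d not_in_keys_iff_lookup_eq_zero[of y q] \<open>d = 0\<close> by (cases "y = 0") (simp_all add: lookup_single)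
  qed
  moreover have "Poly_Mapping.lookup q 0 \<noteq> 0" using d \<open>d = 0\<close> in_keys_iff[of 0 q] by simp
  ultimately show ?thesis using single_unit by metis
qed

text \<open>
The degree in \<open>x\<close> is additive and equals one for the binomial, so one of two factors does not contain \<open>x\<close>.
\<close>

lemma irreducible_mon_diff:
  assumes "Poly_Mapping.keys u \<inter> Poly_Mapping.keys v = {}" and x: "Poly_Mapping.lookup u x = 1"
  shows "irreducible (mon u - mon v :: ('x, 'k::field) mpoly)"
proof (rule irreducibleI)
  let ?f = "mon u - mon v :: ('x, 'k) mpoly"
  have vx: "Poly_Mapping.lookup v x = 0" using assms by (metis disjoint_iff in_keys_iff zero_neq_one)
  hence uv: "u \<noteq> v" using x by auto
  note k = keys_mon_diff(1)[OF uv, where ?'k = 'k]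
  have "Poly_Mapping.keys ?f \<noteq> {}" unfolding k by simp
  thus f0: "?f \<noteq> 0" by (simp only: keys_eq_empty not_False_eq_True)
  show "\<not> ?f dvd 1"
  proof
    assume "?f dvd 1"
    then obtain g where g: "g * ?f = 1" by (metis dvd_def mult.commute)
    have "\<exists>b. Poly_Mapping.keys ?f = {b}"
    proof (rule face_of_product(2)[of "Poly_Mapping.keys g" g _ _ 0])
      show "Poly_Mapping.keys g \<noteq> {}" using g by (auto simp only: keys_eq_empty mult_zero_left zero_neq_one)
      show "Poly_Mapping.keys ?f \<noteq> {}" unfolding k by simp
    next
      fix a b assume "a + b \<in> Poly_Mapping.keys (g * ?f)"
      thus "a + b = 0" unfolding g by simp
    qed simp_all
    thus False using k uv by (metis doubleton_eq_iff insert_absorb2)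
  qed
  fix p q assume pq: "?f = p * q"
  define A where "A = {a \<in> Poly_Mapping.keys p. \<forall>a' \<in> Poly_Mapping.keys p. Poly_Mapping.lookup a' x \<le> Poly_Mapping.lookup a x}"
  define B where "B = {a \<in> Poly_Mapping.keys q. \<forall>a' \<in> Poly_Mapping.keys q. Poly_Mapping.lookup a' x \<le> Poly_Mapping.lookup a x}"
  have max: "\<exists>a\<in>X. \<forall>a'\<in>X. Poly_Mapping.lookup a' x \<le> Poly_Mapping.lookup a x" if "finite X" "X \<noteq> {}" for X :: "('x \<Rightarrow>\<^sub>0 nat) set"
    by (rule finite_has_greatest_value[OF that])
  have ne: "Poly_Mapping.keys p \<noteq> {}" "Poly_Mapping.keys q \<noteq> {}" using f0 pq by auto
  have AB: "A \<noteq> {}" "B \<noteq> {}" using max[OF _ ne(1)] max[OF _ ne(2)] by (auto simp: A_def B_def)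
  have "\<exists>a\<in>A. \<exists>b\<in>B. a + b \<in> Poly_Mapping.keys (p * q)"
  proof (rule face_of_product(1)[OF _ AB(1) _ AB(2)])
    fix a b a' b' assume h: "a \<in> A" "b \<in> B" "a' \<in> Poly_Mapping.keys p" "b' \<in> Poly_Mapping.keys q" "a' + b' = a + b"
    hence "Poly_Mapping.lookup a' x + Poly_Mapping.lookup b' x = Poly_Mapping.lookup a x + Poly_Mapping.lookup b x"
      by (metis lookup_add)
    moreover have "Poly_Mapping.lookup a' x \<le> Poly_Mapping.lookup a x" "Poly_Mapping.lookup b' x \<le> Poly_Mapping.lookup b x"
      using h by (auto simp: A_def B_def)
    ultimately have "Poly_Mapping.lookup a' x = Poly_Mapping.lookup a x" "Poly_Mapping.lookup b' x = Poly_Mapping.lookup b x" by linarith+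
    thus "a' \<in> A \<and> b' \<in> B" using h by (auto simp: A_def B_def)
  qed (auto simp: A_def B_def)
  then obtain a b where ab: "a \<in> A" "b \<in> B" "a + b \<in> {u, v}" using pq k by metis
  hence "Poly_Mapping.lookup a x + Poly_Mapping.lookup b x \<le> 1" using x vx by (auto simp flip: lookup_add)
  hence "Poly_Mapping.lookup a x = 0 \<or> Poly_Mapping.lookup b x = 0" by linarith
  thus "p dvd 1 \<or> q dvd 1"
  proof
    assume "Poly_Mapping.lookup a x = 0"
    hence "\<And>a'. a' \<in> Poly_Mapping.keys p \<Longrightarrow> Poly_Mapping.lookup a' x = 0" using ab(1) by (auto simp: A_def)
    thus ?thesis using linear_factor_unit[of q p u v x] assms pq by (simp add: mult.commute)
  next
    assume "Poly_Mapping.lookup b x = 0"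
    hence "\<And>a'. a' \<in> Poly_Mapping.keys q \<Longrightarrow> Poly_Mapping.lookup a' x = 0" using ab(2) by (auto simp: B_def)
    thus ?thesis using linear_factor_unit[of p q u v x] assms pq by simp
  qed
qed

section \<open>Binomials of the toric ideal as pairs of edge multisets\<close>

definition exponent :: "'x multiset \<Rightarrow> 'x \<Rightarrow>\<^sub>0 nat" where
  "exponent M = Abs_poly_mapping (count M)"

lemma lookup_exponent [simp]: "Poly_Mapping.lookup (exponent M) x = count M x"
  by (simp add: exponent_def)

lemma keys_exponent [simp]: "Poly_Mapping.keys (exponent M) = set_mset M"
  by (auto simp: in_keys_iff)

lemma exponent_surj: obtains M where "u = exponent M"
proof
  have "finite {x. 0 < Poly_Mapping.lookup u x}" using finite_lookup[of u] by simp
  hence "count (Abs_multiset (Poly_Mapping.lookup u)) = Poly_Mapping.lookup u" by simp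
  thus "u = exponent (Abs_multiset (Poly_Mapping.lookup u))" by (simp add: exponent_def)
qed

lemma exponent_inject [simp]: "exponent M = exponent N \<longleftrightarrow> M = N"
  by (metis lookup_exponent multiset_eqI)

lemma mon_degree_exponent: "mon_degree (exponent M) = size M"
  by (simp add: mon_degree_def size_multiset_overloaded_eq)

lemma total_degree_mon_diff:
  assumes "u \<noteq> v"
  shows "total_degree (mon u - mon v :: ('x, 'k::field) mpoly) = max (mon_degree u) (mon_degree v)"
  unfolding total_degree_def keys_mon_diff(1)[OF assms] by simp

lemma lookup_incidence_column:
  "finite e \<Longrightarrow> Poly_Mapping.lookup (incidence_column e) v = of_bool (v \<in> e)"
  unfolding incidence_column_def lookup_sum lookup_single when_def by (simp add: sum.delta)

text \<open>
The incidence matrix applied to \<open>u\<close>, with multiples written as iterated sums.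
\<close>

definition image_exponent :: "('v set \<Rightarrow>\<^sub>0 nat) \<Rightarrow> 'v \<Rightarrow>\<^sub>0 int" where
  "image_exponent u = (\<Sum>e\<in>Poly_Mapping.keys u. \<Sum>i<Poly_Mapping.lookup u e. incidence_column e)"

lemma single_power: "(Poly_Mapping.single a (1 :: 'k::field)) ^ n = Poly_Mapping.single (\<Sum>i<n. a) 1"
  for a :: "'a::comm_monoid_add"
  by (induction n) (simp_all add: mult_single add.commute)

lemma prod_single: "finite A \<Longrightarrow> (\<Prod>x\<in>A. Poly_Mapping.single (f x) (1 :: 'k::field)) = Poly_Mapping.single (\<Sum>x\<in>A. f x) 1"
  for f :: "'b \<Rightarrow> 'a::comm_monoid_add"
  by (induction rule: finite_induct) (simp_all add: mult_single)

lemma toric_hom_mon_diff: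
  assumes "u \<noteq> v"
  shows "toric_hom (mon u - mon v :: ('v set, 'k::field) mpoly) =
    Poly_Mapping.single (image_exponent u) 1 - Poly_Mapping.single (image_exponent v) 1"
  unfolding toric_hom_def keys_mon_diff(1)[OF assms] using assms
  by (simp add: keys_mon_diff[OF assms] single_power prod_single mult_single image_exponent_def single_uminus)

lemma lookup_image_exponent:
  assumes "\<And>e. e \<in> Poly_Mapping.keys u \<Longrightarrow> finite e"
  shows "Poly_Mapping.lookup (image_exponent u) v =
    (\<Sum>e\<in>Poly_Mapping.keys u. if v \<in> e then int (Poly_Mapping.lookup u e) else 0)"
  unfolding image_exponent_def lookup_sum using assms
  by (intro sum.cong) (auto simp: lookup_incidence_column)

lemma mon_diff_in_toric_ideal:
  assumes "u \<noteq> v"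
  shows "mon u - mon v \<in> (toric_ideal E :: ('v set, 'k::field) mpoly set) \<longleftrightarrow>
    Poly_Mapping.keys u \<subseteq> E \<and> Poly_Mapping.keys v \<subseteq> E \<and> image_exponent u = image_exponent v"
proof -
  have "Poly_Mapping.single (image_exponent u) (1 :: 'k) - Poly_Mapping.single (image_exponent v) 1 = 0
     \<longleftrightarrow> image_exponent u = image_exponent v"
    by (metis right_minus_eq lookup_single_eq lookup_single_not_eq zero_neq_one)
  thus ?thesis
    unfolding toric_ideal_def polys_in_def mem_Collect_eq keys_mon_diff(1)[OF assms] toric_hom_mon_diff[OF assms] by auto
qed

lemma deg_conv_sum: "deg M v = (\<Sum>e\<in>set_mset M. if v \<in> e then count M e else 0)"
proof -
  have "deg M v = (\<Sum>e\<in>set_mset M \<inter> {e. v \<in> e}. count M e)"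
    unfolding deg_def size_multiset_overloaded_eq by (intro sum.cong) auto
  thus ?thesis by (simp add: sum.inter_restrict)
qed

lemma exponent_diff_in_toric_ideal:
  assumes "R \<noteq> B" "\<And>e. e \<in> E \<Longrightarrow> finite e"
  shows "mon (exponent R) - mon (exponent B) \<in> (toric_ideal E :: ('v set, 'k::field) mpoly set) \<longleftrightarrow>
    set_mset R \<subseteq> E \<and> set_mset B \<subseteq> E \<and> balanced R B"
proof -
  have "image_exponent (exponent R) = image_exponent (exponent B) \<longleftrightarrow> balanced R B"
    if "set_mset R \<subseteq> E" "set_mset B \<subseteq> E"
  proof -
    have "Poly_Mapping.lookup (image_exponent (exponent M)) v = int (deg M v)" if "set_mset M \<subseteq> E" for M v
      using that assms(2) by (subst lookup_image_exponent) (auto simp: deg_conv_sum intro!: sum.cong)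
    thus ?thesis using that by (auto simp: poly_mapping_eq_iff balanced_def fun_eq_iff)
  qed
  thus ?thesis using assms(1) by (subst mon_diff_in_toric_ideal) auto
qed

lemma mon_dvd_mon:
  assumes "M \<subseteq># N"
  shows "(mon (exponent M) :: ('x, 'k::field) mpoly) dvd mon (exponent N)"
proof
  have "exponent N = exponent M + exponent (N - M)"
    using assms by (intro poly_mapping_eqI) (auto simp: lookup_add mset_subset_eq_count)
  thus "(mon (exponent N) :: ('x, 'k) mpoly) = mon (exponent M) * mon (exponent (N - M))"
    by (simp add: mon_def mult_single)
qed

lemma var_dvd_mon: "(var e :: ('x, 'k::field) mpoly) dvd mon u \<longleftrightarrow> e \<in> Poly_Mapping.keys u"
proof
  assume "(var e :: ('x, 'k) mpoly) dvd mon u"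
  then obtain q :: "('x, 'k) mpoly" where q: "mon u = var e * q" by (rule dvdE)
  have "u \<in> Poly_Mapping.keys (var e * q)" unfolding q[symmetric] by (simp add: mon_def)
  from subsetD[OF keys_mult this] obtain k where "u = Poly_Mapping.single e 1 + k" by (auto simp: var_def)
  thus "e \<in> Poly_Mapping.keys u" by (simp add: in_keys_iff lookup_add)
next
  assume e: "e \<in> Poly_Mapping.keys u"
  obtain M where M: "u = exponent M" by (rule exponent_surj)
  have "(mon (exponent {#e#}) :: ('x, 'k) mpoly) dvd mon (exponent M)" using e M by (intro mon_dvd_mon) simp
  moreover have "exponent {#e#} = Poly_Mapping.single e 1" by (intro poly_mapping_eqI) (simp add: lookup_single when_def)
  ultimately show "(var e :: ('x, 'k) mpoly) dvd mon u" by (simp add: var_def mon_def M)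
qed

lemma binomial_support_eq:
  "binomial_support E (T :: ('v set, 'k::field) mpoly itself) u v = E \<inter> (Poly_Mapping.keys u \<union> Poly_Mapping.keys v)"
  unfolding binomial_support_def var_dvd_mon by (auto simp: in_keys_iff lookup_add)

text \<open>
No nonzero integer vector in the kernel of the incidence matrix has its support properly contained in \<open>S\<close>.
\<close>

definition rigid :: "'v set set \<Rightarrow> bool" where
  "rigid S \<longleftrightarrow> (\<forall>f :: 'v set \<Rightarrow> int. (\<forall>v. (\<Sum>e\<in>S. if v \<in> e then f e else 0) = 0) \<longrightarrow>
     (\<exists>e\<in>S. f e = 0) \<longrightarrow> (\<forall>e\<in>S. f e = 0))"

text \<open>
A binomial in the ideal with smaller support would give, as the difference of its exponents, a kernel
vector supported on \<open>S\<close> and vanishing somewhere on \<open>S\<close>. By rigidity it is zero, but the two exponents of a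
binomial differ. An edge that occurs exactly once makes the binomial linear in a variable.
\<close>

lemma rigid_circuit:
  assumes fin: "\<And>e. e \<in> E \<Longrightarrow> finite e" and sub: "set_mset R \<union> set_mset B \<subseteq> E"
    and disj: "set_mset R \<inter> set_mset B = {}" and bal: "balanced R B" and e0: "count R e0 = 1"
    and rigid: "rigid (set_mset R \<union> set_mset B)"
  shows "mon (exponent R) - mon (exponent B) \<in> (circuits E :: ('v set, 'k::field) mpoly set)"
    and "total_degree (mon (exponent R) - mon (exponent B) :: ('v set, 'k) mpoly) = max (size R) (size B)"
proof -
  let ?S = "set_mset R \<union> set_mset B"
  have RB: "R \<noteq> B" using e0 disj by (metis count_eq_zero_iff disjoint_iff zero_neq_one)
  thus "total_degree (mon (exponent R) - mon (exponent B) :: ('v set, 'k) mpoly) = max (size R) (size B)"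
    by (simp add: total_degree_mon_diff mon_degree_exponent)
  have bin: "(exponent R, exponent B) \<in> binomials E TYPE(('v set, 'k) mpoly)"
    using RB sub bal exponent_diff_in_toric_ideal[OF RB, of E] fin by (simp add: binomials_def)
  have False if uv: "(u, v) \<in> binomials E TYPE(('v set, 'k) mpoly)"
    and lt: "binomial_support E TYPE(('v set, 'k) mpoly) u v \<subset> binomial_support E TYPE(('v set, 'k) mpoly) (exponent R) (exponent B)"
    for u v
  proof -
    have ne: "u \<noteq> v" and T: "mon u - mon v \<in> (toric_ideal E :: ('v set, 'k) mpoly set)" using uv by (auto simp: binomials_def)
    have sub': "Poly_Mapping.keys u \<subseteq> E" "Poly_Mapping.keys v \<subseteq> E" and im: "image_exponent u = image_exponent v"
      using T unfolding mon_diff_in_toric_ideal[OF ne] by auto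
    have lt': "Poly_Mapping.keys u \<union> Poly_Mapping.keys v \<subset> ?S"
      using lt sub sub' unfolding binomial_support_eq by (auto simp: Int_absorb1)
    define f where "f e = int (Poly_Mapping.lookup u e) - int (Poly_Mapping.lookup v e)" for e
    have "(\<Sum>e\<in>?S. if w \<in> e then f e else 0) = 0" for w
    proof -
      have *: "(\<Sum>e\<in>?S. if w \<in> e then int (Poly_Mapping.lookup u e) else 0) = Poly_Mapping.lookup (image_exponent u) w"
        if "Poly_Mapping.keys u \<subseteq> ?S" "Poly_Mapping.keys u \<subseteq> E" for u :: "'v set \<Rightarrow>\<^sub>0 nat"
      proof -
        have "\<And>e. e \<in> Poly_Mapping.keys u \<Longrightarrow> finite e" using that(2) fin by blast
        thus ?thesis using that(1)
          by (subst lookup_image_exponent) (auto intro!: sum.mono_neutral_right simp: in_keys_iff)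
      qed
      have "(\<Sum>e\<in>?S. if w \<in> e then f e else 0) =
         (\<Sum>e\<in>?S. if w \<in> e then int (Poly_Mapping.lookup u e) else 0) - (\<Sum>e\<in>?S. if w \<in> e then int (Poly_Mapping.lookup v e) else 0)"
        unfolding sum_subtractf[symmetric] by (intro sum.cong) (auto simp: f_def)
      thus ?thesis using *[of u] *[of v] lt' sub' im by auto
    qed
    moreover have "\<exists>e\<in>?S. f e = 0"
    proof -
      from lt' obtain e where "e \<in> ?S" "e \<notin> Poly_Mapping.keys u" "e \<notin> Poly_Mapping.keys v" by blast
      thus ?thesis by (intro bexI[of _ e]) (auto simp: f_def in_keys_iff)
    qed
    ultimately have f0: "\<forall>e\<in>?S. f e = 0" using rigid unfolding rigid_def by blast
    have "u = v"
    proof (rule poly_mapping_eqI)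
      fix e
      show "Poly_Mapping.lookup u e = Poly_Mapping.lookup v e"
      proof (cases "e \<in> ?S")
        case True
        hence "f e = 0" using f0 by blast
        thus ?thesis by (simp add: f_def)
      next
        case False
        hence "e \<notin> Poly_Mapping.keys u" "e \<notin> Poly_Mapping.keys v" using lt' by blast+
        thus ?thesis by (simp add: in_keys_iff)
      qed
    qed
    thus False using ne by simp
  qed
  moreover have "irreducible (mon (exponent R) - mon (exponent B) :: ('v set, 'k) mpoly)"
    using disj e0 by (intro irreducible_mon_diff[of _ _ e0]) auto
  ultimately show "mon (exponent R) - mon (exponent B) \<in> (circuits E :: ('v set, 'k) mpoly set)"
    unfolding circuits_def using bin by blast
qed

lemma lookup_pos_part: "Poly_Mapping.lookup (pos_part u) e = nat (Poly_Mapping.lookup u e)"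
  by (simp add: pos_part_def map.rep_eq when_def)

lemma lookup_neg_part: "Poly_Mapping.lookup (neg_part u) e = nat (- Poly_Mapping.lookup u e)"
  by (simp add: neg_part_def map.rep_eq when_def)

text \<open>
A balanced pair of submultisets of \<open>P\<close> and \<open>N\<close> has disjoint supports, so it is the pair of positive and
negative parts of an integer vector, to which the definition of primitive binomials applies.
\<close>

lemma graver_basis_primitive_pair:
  assumes G: "simple_graph V E" and p: "p \<in> (graver_basis E :: ('v set, 'k::field) mpoly set)"
  obtains P N where "p = mon (exponent P) - mon (exponent N)" "primitive_pair P N"
    "set_mset P \<union> set_mset N \<subseteq> E" "set_mset P \<inter> set_mset N = {}" "P \<noteq> {#}"
    "total_degree p = max (size P) (size N)"
proof -
  have E: "\<And>e. e \<in> E \<Longrightarrow> finite e" "\<And>e. e \<in> E \<Longrightarrow> card e = 2"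
    using G by (auto simp: simple_graph_def intro: finite_subset)
  obtain u where pu: "p = mon (pos_part u) - mon (neg_part u)" and pT: "p \<in> toric_ideal E" and irr: "irreducible p"
    and min: "\<And>v. v \<noteq> 0 \<Longrightarrow> v \<noteq> u \<Longrightarrow> mon (pos_part v) - mon (neg_part v) \<in> (toric_ideal E :: ('v set, 'k) mpoly set) \<Longrightarrow>
                 (mon (pos_part v) :: ('v set, 'k) mpoly) dvd mon (pos_part u) \<Longrightarrow>
                 (mon (neg_part v) :: ('v set, 'k) mpoly) dvd mon (neg_part u) \<Longrightarrow> False"
    using p unfolding graver_basis_def by blast
  obtain P where P: "pos_part u = exponent P" by (rule exponent_surj)
  obtain N where N: "neg_part u = exponent N" by (rule exponent_surj)
  have cP: "count P e = nat (Poly_Mapping.lookup u e)" for e using lookup_pos_part[of u e] P by simp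
  have cN: "count N e = nat (- Poly_Mapping.lookup u e)" for e using lookup_neg_part[of u e] N by simp
  have pPN: "p = mon (exponent P) - mon (exponent N)" using pu P N by simp
  have PN: "P \<noteq> N" using pPN irr by auto
  have T: "set_mset P \<union> set_mset N \<subseteq> E" "balanced P N"
    using pT E(1) exponent_diff_in_toric_ideal[OF PN, of E, where ?'k = 'k] unfolding pPN by blast+
  have disj: "set_mset P \<inter> set_mset N = {}" 
  proof -
    have "count P e = 0 \<or> count N e = 0" for e unfolding cP cN by linarith
    thus ?thesis by (auto simp: count_eq_zero_iff disjoint_iff)
  qed
  have P0: "P \<noteq> {#}"
  proof
    assume P: "P = {#}"
    then obtain e where e: "e \<in># N" using PN by (metis multiset_nonemptyE)
    hence "card e = 2" using T E by auto
    then obtain v where v: "v \<in> e" by (metis card.empty equals0I zero_neq_numeral)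
    have "deg N v = 0" using T(2) P by (simp add: balanced_def)
    hence "filter_mset (\<lambda>e. v \<in> e) N = {#}" by (simp add: deg_def)
    moreover have "e \<in># filter_mset (\<lambda>e. v \<in> e) N" using e v by simp
    ultimately show False by (metis empty_iff set_mset_empty)
  qed
  have "primitive_pair P N"
    unfolding primitive_pair_def
  proof (intro conjI allI impI)
    fix R B assume R: "R \<subseteq># P" and B: "B \<subseteq># N" and bal: "balanced R B"
    define v where "v = Abs_poly_mapping (\<lambda>e. int (count R e) - int (count B e))"
    have fin: "finite {e. int (count R e) - int (count B e) \<noteq> 0}"
      by (rule finite_subset[of _ "set_mset R \<union> set_mset B"]) (auto simp: not_in_iff)
    have v: "Poly_Mapping.lookup v e = int (count R e) - int (count B e)" for e
      unfolding v_def using fin by simp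
    have RB: "count R e = 0 \<or> count B e = 0" for e
    proof -
      have "count R e \<le> count P e" "count B e \<le> count N e" using R B by (auto simp: mset_subset_eq_count)
      thus ?thesis unfolding cP cN by linarith
    qed
    have pos: "pos_part v = exponent R"
    proof (rule poly_mapping_eqI)
      fix e show "Poly_Mapping.lookup (pos_part v) e = Poly_Mapping.lookup (exponent R) e"
        using RB[of e] by (auto simp: lookup_pos_part v)
    qed
    have neg: "neg_part v = exponent B"
    proof (rule poly_mapping_eqI)
      fix e show "Poly_Mapping.lookup (neg_part v) e = Poly_Mapping.lookup (exponent B) e"
        using RB[of e] by (auto simp: lookup_neg_part v)
    qed
    show "R + B = {#} \<or> R + B = P + N"
    proof (rule ccontr)
      assume c: "\<not> ?thesis"
      have "v \<noteq> u" using c pos neg P N by auto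
      have ne: "R \<noteq> B"
      proof
        assume "R = B"
        hence "count R e = 0" "count B e = 0" for e using RB[of e] by auto
        hence "R = {#}" "B = {#}" by (simp_all add: multiset_eq_iff)
        thus False using c by simp
      qed
      have "v \<noteq> 0" 
      proof
        assume "v = 0"
        hence "count R e = count B e" for e using v[of e] by simp
        thus False using ne multiset_eqI by blast
      qed
      have "set_mset R \<subseteq> E" "set_mset B \<subseteq> E" using T(1) R B by (auto dest: mset_subset_eqD)
      hence "mon (pos_part v) - mon (neg_part v) \<in> (toric_ideal E :: ('v set, 'k) mpoly set)"
        unfolding pos neg using exponent_diff_in_toric_ideal[OF ne E(1)] bal by blast
      moreover have "(mon (pos_part v) :: ('v set, 'k) mpoly) dvd mon (pos_part u)"
        "(mon (neg_part v) :: ('v set, 'k) mpoly) dvd mon (neg_part u)"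
        unfolding pos neg P N using R B by (auto intro: mon_dvd_mon)
      ultimately show False using min \<open>v \<noteq> 0\<close> \<open>v \<noteq> u\<close> by blast
    qed
  qed (rule T)
  moreover have "total_degree p = max (size P) (size N)"
    using PN unfolding pPN by (simp add: total_degree_mon_diff mon_degree_exponent)
  ultimately show thesis using that pPN T disj P0 by blast
qed

section \<open>Even cycles and dumbbells are circuits\<close>

text \<open>
The vertex-\<open>v\<close> entry of the incidence matrix applied to \<open>f\<close>, summed along a list of edges so that it can be
computed by recursion along walks.
\<close>

definition incident_sum :: "('v set \<Rightarrow> int) \<Rightarrow> 'v set list \<Rightarrow> 'v \<Rightarrow> int" where
  "incident_sum f es v = (\<Sum>e\<leftarrow>es. if v \<in> e then f e else 0)"

lemma incident_sum_simps [simp]: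
  "incident_sum f [] v = 0"
  "incident_sum f (e # es) v = (if v \<in> e then f e else 0) + incident_sum f es v"
  "incident_sum f (es @ es') v = incident_sum f es v + incident_sum f es' v"
  by (simp_all add: incident_sum_def)

lemma incident_sum_rev [simp]: "incident_sum f (rev es) v = incident_sum f es v"
  by (induction es) auto

lemma incident_sum_distinct: "distinct es \<Longrightarrow> (\<Sum>e\<in>set es. if v \<in> e then f e else 0) = incident_sum f es v"
  by (simp add: incident_sum_def sum_list_distinct_conv_sum_set)

lemma incident_sum_outside: "v \<notin> set xs \<Longrightarrow> incident_sum f (walk_edges xs) v = 0"
  by (induction xs rule: walk_edges.induct) auto

lemma incident_sum_start:
  assumes "x \<notin> set xs" "xs \<noteq> []"
  shows "incident_sum f (walk_edges (x # xs)) x = f (hd (walk_edges (x # xs)))"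
  using assms incident_sum_outside[of x xs f] by (cases xs) auto

lemma incident_sum_end:
  assumes "x \<notin> set xs" "xs \<noteq> []"
  shows "incident_sum f (walk_edges (xs @ [x])) x = f (last (walk_edges (xs @ [x])))"
proof -
  have "walk_edges (xs @ [x]) = rev (walk_edges (x # rev xs))" using walk_edges_rev[of "x # rev xs"] by simp
  moreover have "walk_edges (x # rev xs) \<noteq> []" using assms by (simp add: walk_edges_eq_Nil_iff)
  ultimately show ?thesis using incident_sum_start[of x "rev xs" f] assms by (simp add: last_rev)
qed

text \<open>
At an inner vertex of the path only the two neighbouring edges contribute, so their values are opposite.
\<close>

lemma alternate_along_path:
  assumes "distinct ms" "a \<notin> set ms" "b \<notin> set ms"
    and "\<forall>v\<in>set ms. incident_sum f (walk_edges (a # ms @ [b])) v = 0"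
  shows "f (last (walk_edges (a # ms @ [b]))) = (-1) ^ length ms * f (hd (walk_edges (a # ms @ [b]))) \<and>
    (\<forall>e\<in>set (walk_edges (a # ms @ [b])). \<bar>f e\<bar> = \<bar>f (hd (walk_edges (a # ms @ [b])))\<bar>)"
  using assms
proof (induction ms arbitrary: a)
  case (Cons m ms)
  let ?E = "walk_edges (m # ms @ [b])"
  have E: "walk_edges (a # (m # ms) @ [b]) = {a, m} # ?E" by simp
  have ne: "?E \<noteq> []" by (simp add: walk_edges_eq_Nil_iff)
  have "\<forall>v\<in>set ms. incident_sum f ?E v = 0"
  proof
    fix v assume "v \<in> set ms"
    hence "v \<notin> {a, m}" "incident_sum f ({a, m} # ?E) v = 0" using Cons.prems unfolding E by auto
    thus "incident_sum f ?E v = 0" by simp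
  qed
  hence IH: "f (last ?E) = (-1) ^ length ms * f (hd ?E)" "\<forall>e\<in>set ?E. \<bar>f e\<bar> = \<bar>f (hd ?E)\<bar>"
    using Cons by auto
  have "incident_sum f ({a, m} # ?E) m = 0" using Cons.prems(4) unfolding E by simp
  moreover have "incident_sum f ?E m = f (hd ?E)" using Cons.prems by (intro incident_sum_start) auto
  ultimately have "f (hd ?E) = - f {a, m}" by simp
  thus ?case unfolding E using IH ne by simp
qed simp

lemma incident_sum_closing:
  assumes "x \<notin> set ms" "ms \<noteq> []"
  shows "incident_sum f (walk_edges (x # ms @ [x])) x =
    f (hd (walk_edges (x # ms @ [x]))) + f (last (walk_edges (x # ms @ [x])))"
proof -
  obtain m ms' where ms: "ms = m # ms'" using assms(2) by (cases ms) auto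
  have "walk_edges (ms @ [x]) \<noteq> []" using ms by (simp add: walk_edges_eq_Nil_iff)
  thus ?thesis using incident_sum_end[OF assms, of f] ms by auto
qed

lemma distinct_walk_edges: "distinct xs \<Longrightarrow> distinct (walk_edges xs)"
proof (induction xs rule: walk_edges.induct)
  case (1 x y zs)
  hence "{x, y} \<notin> set (walk_edges (y # zs))" using walk_edges_subset[of "{x, y}" "y # zs"] by auto
  thus ?case using 1 by simp
qed auto

lemma distinct_cycle_edges:
  assumes "distinct (x # ms)" "length ms \<ge> 2"
  shows "distinct (walk_edges (x # ms @ [x]))"
proof -
  obtain m k ms' where ms: "ms = m # k # ms'" using assms(2) by (metis Suc_le_length_iff numeral_2_eq_2)
  have "distinct (walk_edges (ms @ [x]))" using assms by (intro distinct_walk_edges) simp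
  moreover have "{x, m} \<notin> set (walk_edges (ms @ [x]))"
    using walk_edges_subset[of "{x, m}" "k # ms' @ [x]"] assms(1) unfolding ms by (auto simp: doubleton_eq_iff)
  ultimately show ?thesis by (simp add: ms)
qed

lemma successively_edges_iff: "successively (\<lambda>x y. {x, y} \<in> E) xs \<longleftrightarrow> set (walk_edges xs) \<subseteq> E"
  by (induction xs rule: walk_edges.induct) auto

lemma successively_edges_neq:
  assumes "set (walk_edges xs) \<subseteq> E" "\<And>e. e \<in> E \<Longrightarrow> card e = 2"
  shows "successively (\<noteq>) xs"
  using assms(1)
proof (induction xs rule: walk_edges.induct)
  case (1 x y zs)
  thus ?case using assms(2)[of "{x, y}"] by (auto simp: card_insert_if)
qed auto

lemma closed_walk_balanced:
  assumes "successively (\<noteq>) w" "w \<noteq> []" "hd w = last w" "odd (length w)"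
  shows "balanced (colour_class True (walk_edges w)) (colour_class False (walk_edges w))"
  using balanced_iff_excess[of True "walk_edges w"] excess_walk[OF assms(1,2), of True] assms(3,4) by simp

lemma distinct_colour_classes:
  assumes "distinct es"
  shows "set_mset (colour_class True es) \<inter> set_mset (colour_class False es) = {}"
proof (rule equals0I)
  fix e assume "e \<in> set_mset (colour_class True es) \<inter> set_mset (colour_class False es)"
  hence "count (colour_class True es) e > 0" "count (colour_class False es) e > 0" by auto
  moreover have "count (colour_class True es) e + count (colour_class False es) e = count (mset es) e"
    by (simp flip: colour_class_True_False)
  moreover have "count (mset es) e \<le> 1" using assms by (simp add: distinct_count_atmost_1)
  ultimately show False by linarith
qed

lemma even_cycle_rigid:
  assumes "distinct (x # ms)" "length ms \<ge> 2"
  shows "rigid (set (walk_edges (x # ms @ [x])))"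
  unfolding rigid_def
proof (intro allI impI)
  fix f :: "'a set \<Rightarrow> int"
  let ?L = "walk_edges (x # ms @ [x])"
  assume "\<forall>v. (\<Sum>e\<in>set ?L. if v \<in> e then f e else 0) = 0" and z: "\<exists>e\<in>set ?L. f e = 0"
  hence "\<forall>v. incident_sum f ?L v = 0" using incident_sum_distinct[OF distinct_cycle_edges[OF assms]] by metis
  hence "\<forall>e\<in>set ?L. \<bar>f e\<bar> = \<bar>f (hd ?L)\<bar>" using alternate_along_path[of ms x x f] assms by auto
  thus "\<forall>e\<in>set ?L. f e = 0" using z by (metis abs_0_eq abs_eq_0)
qed

lemma disjoint_three_unions:
  assumes "X1 \<inter> Y1 = {}" "Y2 \<inter> X2 = {}" "X3 \<inter> Y3 = {}" "A \<inter> B = {}" "A \<inter> C = {}" "B \<inter> C = {}"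
    and "X1 \<subseteq> A" "Y1 \<subseteq> A" "X2 \<subseteq> B" "Y2 \<subseteq> B" "X3 \<subseteq> C" "Y3 \<subseteq> C"
  shows "(X1 \<union> X2 \<union> X3) \<inter> (Y1 \<union> Y2 \<union> Y3) = {}"
proof -
  have "X1 \<inter> Y2 = {}" "X1 \<inter> Y3 = {}" "X2 \<inter> Y1 = {}" "X2 \<inter> Y3 = {}" "X3 \<inter> Y1 = {}" "X3 \<inter> Y2 = {}"
    using assms(4-) by (meson Int_mono Int_commute disjoint_iff subset_eq)+
  thus ?thesis using assms(1-3) by (simp add: Int_Un_distrib Int_Un_distrib2 Int_commute)
qed

text \<open>
Two odd cycles joined by the path \<open>P\<close>, one at either end of it; \<open>c\<close> and \<open>d\<close> contain the vertices of the cycles that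
are not on \<open>P\<close>. If \<open>P\<close> is a single vertex, the cycles share that vertex.
\<close>

locale dumbbell =
  fixes E :: "'v set set" and P c d :: "'v list"
  assumes two: "\<And>e. e \<in> E \<Longrightarrow> card e = 2"
    and P: "P \<noteq> []" and dist: "distinct (P @ c @ d)"
    and even: "even (length c)" "c \<noteq> []" "even (length d)" "d \<noteq> []"
    and edges: "set (walk_edges (hd P # c @ [hd P])) \<subseteq> E" "set (walk_edges P) \<subseteq> E"
      "set (walk_edges (last P # d @ [last P])) \<subseteq> E"
begin

abbreviation "C \<equiv> walk_edges (hd P # c @ [hd P])"
abbreviation "D \<equiv> walk_edges (last P # d @ [last P])"
abbreviation "Q \<equiv> walk_edges P"

lemma len2: "length c \<ge> 2" "length d \<ge> 2"
  using even by (cases c; cases d; auto simp: Suc_le_eq)+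

lemma in_P: "hd P \<in> set P" "last P \<in> set P" using P by auto

lemma not_in: "hd P \<notin> set c" "hd P \<notin> set d" "last P \<notin> set c" "last P \<notin> set d"
  using dist in_P by auto

lemma no_common_edge:
  assumes "set xs \<inter> set ys \<subseteq> {z}" "set (walk_edges xs) \<subseteq> E"
  shows "set (walk_edges xs) \<inter> set (walk_edges ys) = {}"
proof (rule ccontr)
  assume "\<not> ?thesis"
  then obtain e where e: "e \<in> set (walk_edges xs)" "e \<in> set (walk_edges ys)" by auto
  hence "e \<subseteq> {z}" using walk_edges_subset[of e xs] walk_edges_subset[of e ys] assms(1) by blast
  hence "card e \<le> 1" using card_mono[of "{z}" e] by simp
  thus False using two[of e] e assms(2) by auto
qed

lemma distinct_edges: "distinct (C @ Q @ D)"
proof -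
  have "distinct C" "distinct Q" "distinct D"
    using dist not_in len2 distinct_cycle_edges[of "hd P" c] distinct_cycle_edges[of "last P" d]
      distinct_walk_edges[of P] by simp_all
  moreover have "set C \<inter> set Q = {}" using dist in_P edges by (intro no_common_edge[of _ _ "hd P"]) auto
  moreover have "set Q \<inter> set D = {}" using dist in_P edges by (intro no_common_edge[of _ _ "last P"]) auto
  moreover have "set C \<inter> set D = {}" using dist not_in edges by (intro no_common_edge[of _ _ "hd P"]) auto
  ultimately show ?thesis by auto
qed

text \<open>
Along an odd cycle the values alternate, so the first and the last edge have the same value \<open>s\<close> and
contribute \<open>2 * s\<close> at the end of the path. The path therefore carries values \<open>\<plusminus> 2 * s\<close>, and the second cycle
carries \<open>\<plusminus> s\<close>; if one value is zero, all are.
\<close>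

lemma rigid_edges: "rigid (set (C @ Q @ D))"
  unfolding rigid_def
proof (intro allI impI)
  fix f :: "'v set \<Rightarrow> int"
  assume "\<forall>v. (\<Sum>e\<in>set (C @ Q @ D). if v \<in> e then f e else 0) = 0" and z: "\<exists>e\<in>set (C @ Q @ D). f e = 0"
  hence "\<forall>v. incident_sum f (C @ Q @ D) v = 0" using incident_sum_distinct[OF distinct_edges] by metis
  hence k: "incident_sum f C v + incident_sum f Q v + incident_sum f D v = 0" for v by (simp add: add.assoc)
  define s t where "s = f (hd C)" and "t = f (hd D)"
  have "\<forall>v\<in>set c. incident_sum f C v = 0"
  proof
    fix v assume "v \<in> set c"
    hence "v \<notin> set P" "v \<notin> set (last P # d @ [last P])" using dist in_P by auto
    thus "incident_sum f C v = 0" using k[of v] by (simp add: incident_sum_outside)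
  qed
  hence C: "f (last C) = s" "\<forall>e\<in>set C. \<bar>f e\<bar> = \<bar>s\<bar>"
    using alternate_along_path[of c "hd P" "hd P" f] dist not_in even by (auto simp: s_def)
  have "\<forall>v\<in>set d. incident_sum f D v = 0"
  proof
    fix v assume "v \<in> set d"
    hence "v \<notin> set P" "v \<notin> set (hd P # c @ [hd P])" using dist in_P by auto
    thus "incident_sum f D v = 0" using k[of v] by (simp add: incident_sum_outside)
  qed
  hence D: "f (last D) = t" "\<forall>e\<in>set D. \<bar>f e\<bar> = \<bar>t\<bar>"
    using alternate_along_path[of d "last P" "last P" f] dist not_in even by (auto simp: t_def)
  have at: "incident_sum f C (hd P) = 2 * s" "incident_sum f D (last P) = 2 * t"
    using incident_sum_closing[of "hd P" c f] incident_sum_closing[of "last P" d f] not_in even C(1) D(1)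
    by (simp_all only: s_def t_def not_False_eq_True)
  show "\<forall>e\<in>set (C @ Q @ D). f e = 0"
  proof (cases "tl P = []")
    case True
    hence P1: "P = [hd P]" using P by (metis list.collapse)
    hence "Q = []" "hd P = last P" by (metis walk_edges.simps(3), metis last.simps)
    hence "2 * s + 2 * t = 0" using k[of "hd P"] at by simp
    hence "\<bar>s\<bar> = \<bar>t\<bar>" by linarith
    hence "\<forall>e\<in>set (C @ Q @ D). \<bar>f e\<bar> = \<bar>s\<bar>" using C(2) D(2) \<open>Q = []\<close> by auto
    thus ?thesis using z by (metis abs_0_eq abs_eq_0)
  next
    case False
    define ms where "ms = butlast (tl P)"
    have Pm: "P = hd P # ms @ [last P]" using P False unfolding ms_def by (metis append_butlast_last_id last_tl list.collapse)
    have dm: "distinct (hd P # ms @ [last P])" "set ms \<subseteq> set P" using dist Pm by (metis distinct_append, metis Un_iff set_append set_subset_Cons subset_iff)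
    have Qm: "Q = walk_edges (hd P # ms @ [last P])" using Pm by metis
    define r where "r = f (hd Q)"
    have "\<forall>v\<in>set ms. incident_sum f Q v = 0"
    proof
      fix v assume "v \<in> set ms"
      hence "v \<notin> set (hd P # c @ [hd P])" "v \<notin> set (last P # d @ [last P])" using dist dm by auto
      thus "incident_sum f Q v = 0" using k[of v] incident_sum_outside[of v _ f] by (metis add.right_neutral add_0)
    qed
    hence Q: "f (last Q) = (-1) ^ length ms * r" "\<forall>e\<in>set Q. \<bar>f e\<bar> = \<bar>r\<bar>"
      using alternate_along_path[of ms "hd P" "last P" f] dm unfolding r_def Qm by auto
    have "incident_sum f Q (hd P) = r" unfolding r_def Qm using dm by (intro incident_sum_start) auto
    moreover have "incident_sum f D (hd P) = 0" using dm not_in by (intro incident_sum_outside) auto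
    ultimately have 1: "2 * s + r = 0" using k[of "hd P"] at by simp
    have "incident_sum f Q (last P) = (-1) ^ length ms * r"
      using incident_sum_end[of "last P" "hd P # ms" f] dm Q(1) unfolding Qm by auto
    moreover have "incident_sum f C (last P) = 0" using dm not_in by (intro incident_sum_outside) auto
    ultimately have "2 * t + (-1) ^ length ms * r = 0" using k[of "last P"] at by simp
    hence "2 * \<bar>t\<bar> = \<bar>r\<bar>" by (cases "Parity.even (length ms)") auto
    hence "f e = 0 \<longleftrightarrow> r = 0" if "e \<in> set (C @ Q @ D)" for e
      using that 1 C(2) D(2) Q(2) by (auto split: if_splits) 
    thus ?thesis using z by blast
  qed
qed

definition walk :: "'v list" where "walk = hd P # c @ P @ d @ rev P"

lemma walk_edges_walk: "walk_edges walk = C @ Q @ D @ rev Q"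
proof -
  obtain P' where P': "P = hd P # P'" using P by (metis list.collapse)
  obtain P'' where P'': "P = P'' @ [last P]" using P by (metis append_butlast_last_id)
  have "walk = (hd P # c) @ hd P # (P' @ d @ rev P)" unfolding walk_def using P' by simp
  hence "walk_edges walk = C @ walk_edges (P @ d @ rev P)"
    using walk_edges_append[of "hd P # c" "hd P" "P' @ d @ rev P"] P' by (metis append_Cons)
  also have "P @ d @ rev P = P'' @ last P # (d @ rev P)" using P'' by (metis append.assoc append_Cons append_Nil)
  also have "walk_edges \<dots> = Q @ walk_edges (last P # d @ rev P)"
    using walk_edges_append[of P'' "last P" "d @ rev P"] P'' by metis
  also have "last P # d @ rev P = (last P # d) @ last P # rev P''" using P'' by (metis append_Cons rev.simps(2) rev_append rev_rev_ident rev_singleton_conv append_Nil)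
  also have "walk_edges \<dots> = D @ walk_edges (last P # rev P'')" using walk_edges_append[of "last P # d" "last P" "rev P''"] by simp
  also have "last P # rev P'' = rev P" using P'' by (metis rev_eq_Cons_iff rev_rev_ident)
  finally show ?thesis by (simp add: walk_edges_rev)
qed

text \<open>
The second cycle is odd, so an edge of the path has the same colour in both directions. The two
colour classes are therefore disjoint, and an edge of the first cycle occurs exactly once. The larger of the
two classes contains at least half of the edges of the walk.
\<close>

lemma large_circuit:
  shows "\<exists>q \<in> (circuits E :: ('v set, 'k::field) mpoly set).
     length c + length d + 2 * length P \<le> 2 * total_degree q"
proof -
  define R B where "R = colour_class True (walk_edges walk)" and "B = colour_class False (walk_edges walk)"
  \<comment> \<open>the first cycle has odd length, so the parity of the path decides the colour of the first edge of \<open>D\<close>\<close>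
  define b where "b = odd (length Q)"
  have l: "odd (length C)" "odd (length D)" using even by simp_all
  have R: "R = colour_class True C + (colour_class False Q + colour_class False Q) + colour_class b D"
    unfolding R_def walk_edges_walk colour_class_append colour_class_rev
    using l by (cases b) (simp_all add: b_def ac_simps del: length_walk_edges)
  have B: "B = colour_class False C + (colour_class True Q + colour_class True Q) + colour_class (\<not> b) D"
    unfolding B_def walk_edges_walk colour_class_append colour_class_rev
    using l by (cases b) (simp_all add: b_def ac_simps del: length_walk_edges)
  have cc: "set_mset (colour_class b' es) \<union> set_mset (colour_class (\<not> b') es) = set es" for b' and es :: "'v set list"
    using colour_class_union[of b' es] by (metis set_mset_mset set_mset_union)
  have S: "set_mset R \<union> set_mset B = set (C @ Q @ D)"
    unfolding R B using cc[of True C] cc[of True Q] cc[of b D] by auto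
  have sub: "set (C @ Q @ D) \<subseteq> E" using edges by auto
  have disj: "set_mset R \<inter> set_mset B = {}"
  proof -
    have "set_mset (colour_class True es) \<inter> set_mset (colour_class False es) = {}" if "es \<in> {C, Q, D}" for es
      using that distinct_edges by (intro distinct_colour_classes) auto
    hence own: "set_mset (colour_class True C) \<inter> set_mset (colour_class False C) = {}"
      "set_mset (colour_class True Q) \<inter> set_mset (colour_class False Q) = {}"
      "set_mset (colour_class b D) \<inter> set_mset (colour_class (\<not> b) D) = {}" by (cases b; auto)+
    have cross: "set C \<inter> set Q = {}" "set C \<inter> set D = {}" "set Q \<inter> set D = {}" using distinct_edges by auto
    have sub: "set_mset (colour_class b' es) \<subseteq> set es" for b' and es :: "'v set list" using cc[of b' es] by blast
    show ?thesis unfolding R B set_mset_union Un_absorb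
      by (rule disjoint_three_unions[OF own cross]) (rule sub)+
  qed
  have wE: "set (walk_edges walk) \<subseteq> E" using edges by (simp add: walk_edges_walk)
  have bal: "balanced R B"
    unfolding R_def B_def
  proof (rule closed_walk_balanced)
    show "successively (\<noteq>) walk" using successively_edges_neq[OF wE two] .
    show "hd walk = last walk" using P by (simp add: walk_def last_rev)
    show "odd (length walk)" using even by (simp add: walk_def)
  qed (simp add: walk_def)
  obtain e es where e: "C = e # es" by (cases c) auto
  have "e \<notin> set es" "e \<notin> set Q" "e \<notin> set D" using distinct_edges e by auto
  moreover have sub1: "set_mset (colour_class b' es) \<subseteq> set es" for b' and es :: "'v set list" using cc[of b' es] by blast
  ultimately have "e \<notin># colour_class False es" "e \<notin># colour_class False Q" "e \<notin># colour_class b D"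
    using sub1 by blast+
  moreover have "colour_class True C = {#e#} + colour_class False es" unfolding e by simp
  ultimately have 1: "count R e = 1" unfolding R by (simp only: count_union count_single not_in_iff) simp
  have fin: "finite e" if "e \<in> E" for e using two[OF that] by (metis card.infinite zero_neq_numeral)
  have rig: "rigid (set_mset R \<union> set_mset B)" unfolding S by (rule rigid_edges)
  have subE: "set_mset R \<union> set_mset B \<subseteq> E" unfolding S by (rule sub)
  have "size R + size B = length (walk_edges walk)"
    unfolding R_def B_def using colour_class_True_False[of "walk_edges walk"] by (metis size_mset size_union)
  also have "\<dots> = length c + length d + 2 * length P" unfolding walk_edges_walk using P by (cases P) auto
  finally have "length c + length d + 2 * length P \<le> 2 * max (size R) (size B)" by linarith
  thus ?thesis
    using rigid_circuit[of E R B e, where ?'k = 'k, OF fin subE disj bal 1 rig] by (metis (no_types, lifting))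
qed

end

section \<open>The degree bound\<close>

lemma size_colour_class:
  "Parity.even (length es) \<Longrightarrow> size (colour_class True es) = size (colour_class False es)"
proof (induction es rule: induct_list012)
  case (3 x y zs)
  thus ?case by simp
qed auto

text \<open>
The path runs from the cycle \<open>c\<close> back along \<open>p\<close> to \<open>x\<close> and then along \<open>q\<close>; the tail of \<open>q\<close> avoids
listing \<open>x\<close> twice.
\<close>

lemma lollipops_dumbbell:
  assumes "\<And>e. e \<in> E \<Longrightarrow> card e = 2"
    and "lollipop (\<lambda>x y. {x, y} \<in> E) x p c" "lollipop (\<lambda>x y. {x, y} \<in> E) x q d"
    and "(set p \<union> set c) \<inter> (set q \<union> set d) = {x}"
  shows "dumbbell E (rev p @ tl q) c d" and "hd (rev p @ tl q) = last p" "last (rev p @ tl q) = last q"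
proof -
  note pc = assms(2)[unfolded lollipop_def] and qd = assms(3)[unfolded lollipop_def]
  obtain p' where p: "p = x # p'" using pc by (cases p) auto
  obtain q' where q: "q = x # q'" using qd by (cases q) auto
  show h: "hd (rev p @ tl q) = last p" using p by (simp add: hd_append hd_rev)
  show l: "last (rev p @ tl q) = last q" using p q by (cases q') auto
  have "x \<notin> set c" "x \<notin> set d" using pc qd p q by auto
  hence dist: "distinct ((rev p @ tl q) @ c @ d)"
    using pc qd assms(4) unfolding p q by auto
  have "rev p @ tl q = rev p' @ x # q'" by (simp add: p q)
  hence "walk_edges (rev p @ tl q) = rev (walk_edges p) @ walk_edges q"
    using walk_edges_append[of "rev p'" x q'] walk_edges_rev[of p] by (simp add: p q)
  moreover have "set (walk_edges p) \<subseteq> E" "set (walk_edges q) \<subseteq> E" using pc qd by (auto simp: successively_edges_iff)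
  ultimately have P: "set (walk_edges (rev p @ tl q)) \<subseteq> E" by simp
  show "dumbbell E (rev p @ tl q) c d"
  proof
    show "set (walk_edges (hd (rev p @ tl q) # c @ [hd (rev p @ tl q)])) \<subseteq> E"
      unfolding h using pc by (simp only: successively_edges_iff)
    show "set (walk_edges (last (rev p @ tl q) # d @ [last (rev p @ tl q)])) \<subseteq> E"
      unfolding l using qd by (simp only: successively_edges_iff)
  qed (use assms(1) dist P pc qd in auto)
qed

lemma odd_closed_walk_lollipop:
  assumes "noncrossing_odd bs" "even (length bs)" "bs \<noteq> []" "x \<notin> set bs"
    and edges: "set (walk_edges (x # bs @ [x])) \<subseteq> E" "\<And>e. e \<in> E \<Longrightarrow> card e = 2"
  obtains p c where "lollipop (\<lambda>x y. {x, y} \<in> E) x p c" "set p \<union> set c \<subseteq> insert x (set bs)"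
    "real (length bs + 1) \<le> lollipop_length p c * exp (lollipop_length p c / exp 1)"
proof -
  have s: "successively (\<noteq>) (x # bs @ [x])" using successively_edges_neq[OF edges] .
  hence "successively (\<noteq>) bs" using successively_append_iff[of "(\<noteq>)" "[x]" "bs @ [x]"] 
    successively_append_iff[of "(\<noteq>)" bs "[x]"] by simp
  then obtain ts where ts: "concat (map word ts) = bs" "\<forall>t \<in> set ts. odd_cactus t" "distinct (concat (map vertices ts))"
    using noncrossing_odd_forest[OF assms(1)] by blast
  let ?t = "Node x ts"
  have sv: "set (concat (map vertices ts)) = set bs" unfolding ts(1)[symmetric] by (simp add: set_word)
  have ne: "ts \<noteq> []" using ts(1) assms(3) by auto
  have w: "word ?t = x # bs @ [x]" using ne ts(1) by simp
  have "\<exists>p c. lollipop (\<lambda>x y. {x, y} \<in> E) (base ?t) p c \<and> set p \<union> set c \<subseteq> set (vertices ?t) \<and>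
     real (length (word ?t) - 1) \<le> lollipop_length p c * exp (lollipop_length p c / exp 1)"
  proof (rule cactus_lollipop)
    show "odd_cactus ?t" using ts assms(2) by simp
    show "distinct (vertices ?t)" using ts(3) sv assms(4) by simp
    show "successively (\<lambda>x y. {x, y} \<in> E) (word ?t)" unfolding w successively_edges_iff by (rule edges(1))
    show "symp (\<lambda>x y. {x, y} \<in> E)" by (simp add: symp_def insert_commute)
  qed (use ne in simp)
  moreover have "set (vertices ?t) = insert x (set bs)" using sv by simp
  ultimately show thesis using that unfolding w by auto
qed

text \<open>
Either the walk of the binomial is an even cycle, and then the binomial is itself a circuit, or it splits
at a repeated vertex into two odd closed walks whose lollipops \<open>q1, c\<close> and \<open>q2, d\<close> form a dumbbell.
\<close>

theorem theorem2p5: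
  fixes V :: "'v set" and E :: "'v set set" and n :: real
  assumes "simple_graph V E"
    and "\<And>c. c \<in> (circuits E :: ('v set, 'k::field) mpoly set) \<Longrightarrow> real (total_degree c) \<le> n"
    and "p \<in> (graver_basis E :: ('v set, 'k) mpoly set)"
  shows "real (total_degree p) \<le> n\<^sup>2 * exp (2 * n / exp 1)"
proof -
  have card2: "\<And>e. e \<in> E \<Longrightarrow> card e = 2" using assms(1) by (simp add: simple_graph_def)
  have fin: "\<And>e. e \<in> E \<Longrightarrow> finite e" using card2 by (metis card.infinite zero_neq_numeral)
  obtain P N where p: "p = mon (exponent P) - mon (exponent N)" and prim: "primitive_pair P N"
    and sub: "set_mset P \<union> set_mset N \<subseteq> E" and disj: "set_mset P \<inter> set_mset N = {}" and P0: "P \<noteq> {#}"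
    and deg: "total_degree p = max (size P) (size N)"
    using graver_basis_primitive_pair[OF assms(1,3)] by blast
  have "\<forall>e \<in># P + N. card e = 2" using sub card2 by auto
  then obtain w where w: "length w \<ge> 2" "successively (\<noteq>) w" "hd w = last w" "odd (length w)"
    and wP: "colour_class True (walk_edges w) = P" and wN: "colour_class False (walk_edges w) = N"
    using primitive_pair_closed_walk[OF prim _ P0] by blast
  have mw: "mset (walk_edges w) = P + N" using colour_class_True_False[of "walk_edges w"] wP wN by simp
  hence wE: "set (walk_edges w) \<subseteq> E" using sub by (metis set_mset_mset set_mset_union)
  have "size P = size N" using size_colour_class[of "walk_edges w"] w(4) wP wN by simp
  hence deg2: "2 * total_degree p = length (walk_edges w)" unfolding deg using mw
    by (metis max.idem mult_2 size_mset size_union)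
  have p1: "total_degree p \<ge> 1" using deg P0 by (metis One_nat_def Suc_leI less_max_iff_disj nonempty_has_size)
  have "primitive_walk w" using w prim wP wN by (simp add: primitive_walk_def)
  hence "1 \<le> n \<and> real (total_degree p) \<le> n * exp (2 * n / exp 1)"
  proof (cases rule: primitive_walk_cases)
    case 1
    obtain x ms where wx: "w = x # ms @ [x]"
    proof -
      obtain x w' where w': "w = x # w'" using w(1) by (cases w) auto
      moreover have "w' \<noteq> []" using w(1) w' by auto
      ultimately show thesis using that[of x "butlast w'"] w(3) by (metis append_butlast_last_id last_ConsR list.sel(1))
    qed
    have dist: "distinct (x # ms)" using 1 wx by auto
    have odd: "odd (length ms)" using w(4) wx by simp
    \<comment> \<open>a walk that crosses one edge back and forth would put this edge into both \<open>P\<close> and \<open>N\<close>\<close>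
    have "length ms \<noteq> 1"
    proof
      assume "length ms = 1"
      then obtain m where "ms = [m]" by (auto simp: length_Suc_conv)
      hence "P = {#{x, m}#}" "N = {#{x, m}#}" using wP wN wx by (auto simp: insert_commute)
      thus False using disj by simp
    qed
    hence len: "length ms \<ge> 2" using odd by (cases "length ms") auto
    have S: "set_mset P \<union> set_mset N = set (walk_edges w)" using mw by (metis set_mset_mset set_mset_union)
    obtain e es where e: "walk_edges w = e # es" using wx by (cases ms) auto
    have "e \<notin> set es" using distinct_cycle_edges[OF dist len] wx e by simp
    hence "count P e + count N e = 1" unfolding count_union[symmetric] mw[symmetric] e
      by (simp add: count_eq_zero_iff)
    moreover have "e \<in># P" unfolding wP[symmetric] e by simp
    hence "count P e \<ge> 1" by simp
    ultimately have "count P e = 1" by linarith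
    moreover have "balanced P N" using prim by (simp add: primitive_pair_def)
    moreover have "rigid (set_mset P \<union> set_mset N)" unfolding S wx by (rule even_cycle_rigid[OF dist len])
    ultimately have "p \<in> circuits E" unfolding p using sub disj fin by (intro rigid_circuit(1)) auto
    hence le: "real (total_degree p) \<le> n" by (rule assms(2))
    hence "1 \<le> n" using p1 by linarith
    moreover have "n * 1 \<le> n * exp (2 * n / exp 1)" using \<open>1 \<le> n\<close> by (intro mult_left_mono) auto
    ultimately show ?thesis using le by linarith
  next
    case (2 x bs cs)
    let ?w = "x # bs @ x # cs @ [x]"
    have E: "walk_edges ?w = walk_edges (x # bs @ [x]) @ walk_edges (x # cs @ [x])"
      using walk_edges_append[of "x # bs" x "cs @ [x]"] by simp
    have sE: "set (walk_edges (x # bs @ [x])) \<subseteq> E" "set (walk_edges (x # cs @ [x])) \<subseteq> E"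
    proof -
      have "set (walk_edges ?w) \<subseteq> E" using wE 2(2) by (metis set_mset_mset)
      thus "set (walk_edges (x # bs @ [x])) \<subseteq> E" "set (walk_edges (x # cs @ [x])) \<subseteq> E" unfolding E by auto
    qed
    have ne: "bs \<noteq> []" "cs \<noteq> []"
      using successively_edges_neq[OF sE(1) card2] successively_edges_neq[OF sE(2) card2] by auto
    have ncw: "noncrossing_odd (x # bs @ x # cs)" using primitive_walk_noncrossing_odd[OF 2(1)] by (simp add: butlast_append)
    hence nc: "noncrossing_odd bs" "noncrossing_odd cs"
      using noncrossing_odd_sub[of "[x]" bs "x # cs"] noncrossing_odd_sub[of "x # bs @ [x]" cs "[]"] by auto
    have out: "x \<notin> set bs" "x \<notin> set cs" using noncrossing_odd_thrice[OF ncw, of "[]" x bs cs] by auto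
    have dj: "set bs \<inter> set cs = {}" using noncrossing_odd_disjoint[OF ncw, of "[]" x bs cs] by simp
    have ev: "even (length bs)" using ncw unfolding noncrossing_odd_def by (metis append_Nil)
    have "odd (length ?w)" using 2(1) by (simp add: primitive_walk_def)
    hence ev': "even (length cs)" using ev by simp
    obtain q1 c where L1: "lollipop (\<lambda>x y. {x, y} \<in> E) x q1 c" "set q1 \<union> set c \<subseteq> insert x (set bs)"
      "real (length bs + 1) \<le> lollipop_length q1 c * exp (lollipop_length q1 c / exp 1)"
      using odd_closed_walk_lollipop[OF nc(1) ev ne(1) out(1) sE(1) card2] by blast
    obtain q2 d where L2: "lollipop (\<lambda>x y. {x, y} \<in> E) x q2 d" "set q2 \<union> set d \<subseteq> insert x (set cs)"
      "real (length cs + 1) \<le> lollipop_length q2 d * exp (lollipop_length q2 d / exp 1)"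
      using odd_closed_walk_lollipop[OF nc(2) ev' ne(2) out(2) sE(2) card2] by blast
    have "x \<in> set q1" "x \<in> set q2" using L1(1) L2(1) unfolding lollipop_def by (metis hd_in_set)+
    hence "(set q1 \<union> set c) \<inter> (set q2 \<union> set d) = {x}" using L1(2) L2(2) dj out by auto
    then interpret dumbbell E "rev q1 @ tl q2" c d
      using lollipops_dumbbell[OF card2 L1(1) L2(1)] by blast
    define H1 H2 where "H1 = lollipop_length q1 c" and "H2 = lollipop_length q2 d"
    obtain g where g: "g \<in> (circuits E :: ('v set, 'k) mpoly set)"
      "length c + length d + 2 * length (rev q1 @ tl q2) \<le> 2 * total_degree g" using large_circuit by blast
    have "q1 \<noteq> []" "q2 \<noteq> []" using L1(1) L2(1) by (auto simp: lollipop_def)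
    hence "H1 + H2 \<le> 2 * total_degree g" using g(2) unfolding H1_def H2_def lollipop_length_def
      by (cases q1; cases q2) auto
    moreover have "real (total_degree g) \<le> n" by (rule assms(2)[OF g(1)])
    ultimately have H: "real H1 + real H2 \<le> 2 * n" by linarith
    have pos: "H1 \<ge> 1" "H2 \<ge> 1" by (auto simp: H1_def H2_def lollipop_length_def)
    have "length (walk_edges w) = length (walk_edges ?w)" using 2(2) by (metis size_mset)
    hence "2 * real (total_degree p) = real (length bs + 1) + real (length cs + 1)" using deg2 by simp
    also have "\<dots> \<le> H1 * exp (H1 / exp 1) + H2 * exp (H2 / exp 1)"
      using L1(3) L2(3) by (simp add: H1_def H2_def)
    also have "\<dots> \<le> H1 * exp (2 * n / exp 1) + H2 * exp (2 * n / exp 1)"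
      using H by (intro add_mono mult_left_mono) (auto simp: divide_right_mono)
    also have "\<dots> = (real H1 + real H2) * exp (2 * n / exp 1)" by (simp add: algebra_simps)
    also have "\<dots> \<le> 2 * n * exp (2 * n / exp 1)" using H by (intro mult_right_mono) auto
    finally show ?thesis using H pos by simp
  qed
  hence n: "1 \<le> n" "real (total_degree p) \<le> n * exp (2 * n / exp 1)" by auto
  have "n * exp (2 * n / exp 1) \<le> (n * n) * exp (2 * n / exp 1)" using n(1) by (intro mult_right_mono) auto
  thus ?thesis using n(2) by (simp add: power2_eq_square)
qed

end
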